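(* Let $n\ge 2$. The quotient group $VB_n/\Gamma_2(KB_n)$ is crystallographic if and only if $n=2$.
   Context: A group $\Pi$ is crystallographic if there are $m\in\mathbb{N}$ and a short exact sequence $0\to\mathbb{Z}^m\to\Pi\to\Phi\to1$ with $\Phi$ finite such that the representation $\Phi\to\mathrm{Aut}(\mathbb{Z}^m)$ induced by conjugation is faithful. $\Gamma_2(H)=[H,H]$. $VB_n$ is the group with generators $\sigma_i,\rho_i$ ($1\le i\le n-1$) and relations: $\sigma_i\sigma_{i+1}\sigma_i=\sigma_{i+1}\sigma_i\sigma_{i+1}$, $\rho_i\rho_{i+1}\rho_i=\rho_{i+1}\rho_i\rho_{i+1}$, $\rho_i\rho_{i+1}\sigma_i=\sigma_{i+1}\rho_i\rho_{i+1}$ for $1\le i\le n-2$; $\rho_i^2=1$; and $\sigma_i\sigma_j=\sigma_j\sigma_i$, $\rho_i\rho_j=\rho_j\rho_i$, $\sigma_i\rho_j=\rho_j\sigma_i$ for $|i-j|\ge 2$. $KB_n$ is the kernel of the homomorphism $\pi_K\colon VB_n\to S_n$ given by $\pi_K(\sigma_i)=1$, $\pi_K(\rho_i)=(i,i+1)$. *)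

theory Defs
  imports
    "HOL-Algebra.Sym_Groups"
    "HOL-Algebra.Product_Groups"
    "HOL-Algebra.Elementary_Groups"
    "HOL-Algebra.Generated_Groups"
    "HOL-Algebra.Bij"
begin

section \<open>Groups given by generators and relations\<close>

text \<open>A letter \<open>(x, True)\<close> stands for the generator \<open>x\<close>, and \<open>(x, False)\<close> for its inverse.
  A relation \<open>u = v\<close> is the pair of words \<open>(u, v)\<close>.\<close>

type_synonym 'g gword = "('g \<times> bool) list"

definition gwords :: "'g set \<Rightarrow> 'g gword set" where
  "gwords X = lists (X \<times> UNIV)"

inductive_set word_eq :: "'g set \<Rightarrow> ('g gword \<times> 'g gword) set \<Rightarrow> ('g gword \<times> 'g gword) set"
  for X :: "'g set" and R :: "('g gword \<times> 'g gword) set" where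
  refl: "w \<in> gwords X \<Longrightarrow> (w, w) \<in> word_eq X R"
| sym: "(u, v) \<in> word_eq X R \<Longrightarrow> (v, u) \<in> word_eq X R"
| trans: "(u, v) \<in> word_eq X R \<Longrightarrow> (v, w) \<in> word_eq X R \<Longrightarrow> (u, w) \<in> word_eq X R"
| append: "(u, v) \<in> word_eq X R \<Longrightarrow> (u', v') \<in> word_eq X R \<Longrightarrow> (u @ u', v @ v') \<in> word_eq X R"
| cancel: "x \<in> X \<Longrightarrow> ([(x, b), (x, \<not> b)], []) \<in> word_eq X R"
| relation: "(u, v) \<in> R \<Longrightarrow> u \<in> gwords X \<Longrightarrow> v \<in> gwords X \<Longrightarrow> (u, v) \<in> word_eq X R"

definition word_class :: "'g set \<Rightarrow> ('g gword \<times> 'g gword) set \<Rightarrow> 'g gword \<Rightarrow> 'g gword set" where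
  "word_class X R w = word_eq X R `` {w}"

definition presented_group ::
  "'g set \<Rightarrow> ('g gword \<times> 'g gword) set \<Rightarrow> 'g gword set monoid" where
  "presented_group X R =
    \<lparr>carrier = gwords X // word_eq X R,
     mult = (\<lambda>A B. \<Union>u\<in>A. \<Union>v\<in>B. word_class X R (u @ v)),
     one = word_class X R []\<rparr>"

fun word_eval :: "('a, 'm) monoid_scheme \<Rightarrow> ('g \<Rightarrow> 'a) \<Rightarrow> 'g gword \<Rightarrow> 'a" where
  "word_eval G f [] = \<one>\<^bsub>G\<^esub>"
| "word_eval G f ((x, b) # w) = (if b then f x else inv\<^bsub>G\<^esub> f x) \<otimes>\<^bsub>G\<^esub> word_eval G f w"

text \<open>The homomorphism from a presented group determined by its values \<open>f\<close> on generators.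
  It is meaningful when \<open>f\<close> respects the relations; see \<open>presented_hom_class\<close> below.\<close>

definition presented_hom :: "('a, 'm) monoid_scheme \<Rightarrow> ('g \<Rightarrow> 'a) \<Rightarrow> 'g gword set \<Rightarrow> 'a" where
  "presented_hom G f A = the_elem (word_eval G f ` A)"

lemma gwords_Nil [simp]: "[] \<in> gwords X"
  and gwords_Cons [simp]: "(a # w) \<in> gwords X \<longleftrightarrow> fst a \<in> X \<and> w \<in> gwords X"
  and gwords_append [simp]: "u @ v \<in> gwords X \<longleftrightarrow> u \<in> gwords X \<and> v \<in> gwords X"
  by (auto simp: gwords_def mem_Times_iff)

lemma word_eq_gwords: "(u, v) \<in> word_eq X R \<Longrightarrow> u \<in> gwords X \<and> v \<in> gwords X"
  by (induction rule: word_eq.induct) auto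

lemma equiv_word_eq: "equiv (gwords X) (word_eq X R)"
proof (rule equivI)
  show "word_eq X R \<subseteq> gwords X \<times> gwords X" using word_eq_gwords by fast
  show "refl_on (gwords X) (word_eq X R)"
    by (rule refl_onI) (rule word_eq.refl)
  show "sym (word_eq X R)" by (rule symI) (rule word_eq.sym)
  show "trans (word_eq X R)" by (rule transI) (rule word_eq.trans)
qed

lemma word_class_eq_iff:
  assumes "u \<in> gwords X" "v \<in> gwords X"
  shows "word_class X R u = word_class X R v \<longleftrightarrow> (u, v) \<in> word_eq X R"
  unfolding word_class_def using eq_equiv_class_iff[OF equiv_word_eq assms] .

lemma carrier_presented_group: "carrier (presented_group X R) = word_class X R ` gwords X"
  by (auto simp: presented_group_def word_class_def quotient_def)

lemma one_presented_group: "\<one>\<^bsub>presented_group X R\<^esub> = word_class X R []"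
  by (simp add: presented_group_def)

lemma mult_presented_group:
  assumes "u \<in> gwords X" "v \<in> gwords X"
  shows "word_class X R u \<otimes>\<^bsub>presented_group X R\<^esub> word_class X R v = word_class X R (u @ v)"
proof -
  let ?C = "word_class X R"
  have *: "?C (u' @ v') = ?C (u @ v)" if "u' \<in> ?C u" "v' \<in> ?C v" for u' v'
  proof -
    have "(u, u') \<in> word_eq X R" "(v, v') \<in> word_eq X R"
      using that by (simp_all add: word_class_def)
    from word_eq.append[OF this] have uv: "(u @ v, u' @ v') \<in> word_eq X R" .
    then show ?thesis
      using word_class_eq_iff[of "u @ v" X "u' @ v'" R] word_eq_gwords[OF uv] by simp
  qed
  have ne: "u \<in> ?C u" "v \<in> ?C v"
    unfolding word_class_def by (simp_all add: assms word_eq.refl)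
  have inner: "(\<Union>v'\<in>?C v. ?C (u' @ v')) = ?C (u @ v)" if "u' \<in> ?C u" for u'
    by (rule SUP_eq_const) (use that * ne(2) in blast)+
  have "(\<Union>u'\<in>?C u. \<Union>v'\<in>?C v. ?C (u' @ v')) = ?C (u @ v)"
    by (rule SUP_eq_const) (use inner ne(1) in blast)+
  then show ?thesis by (simp add: presented_group_def)
qed

lemma gwords_left_inverse:
  "w \<in> gwords X \<Longrightarrow> \<exists>w'\<in>gwords X. (w' @ w, []) \<in> word_eq X R"
proof (induction w)
  case Nil
  show ?case by (auto intro!: bexI[of _ "[]"] word_eq.refl)
next
  case (Cons a w)
  obtain x b where a: "a = (x, b)" by fastforce
  from Cons obtain w' where w': "w' \<in> gwords X" "(w' @ w, []) \<in> word_eq X R" by auto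
  have x: "x \<in> X" and w: "w \<in> gwords X" using Cons.prems a by auto
  have "([(x, \<not> b), (x, b)], []) \<in> word_eq X R"
    using word_eq.cancel[OF x, of "\<not> b"] by simp
  from word_eq.append[OF word_eq.append[OF word_eq.refl[OF w'(1)] this] word_eq.refl[OF w]]
  have "((w' @ [(x, \<not> b)]) @ a # w, w' @ w) \<in> word_eq X R"
    by (simp add: a)
  from word_eq.trans[OF this w'(2)]
  have "((w' @ [(x, \<not> b)]) @ a # w, []) \<in> word_eq X R" .
  moreover have "w' @ [(x, \<not> b)] \<in> gwords X" using w' x by simp
  ultimately show ?case by blast
qed

lemma group_presented_group: "group (presented_group X R)"
proof (rule groupI, goal_cases)
  case (5 A)
  then obtain w where w: "w \<in> gwords X" "A = word_class X R w"
    by (auto simp: carrier_presented_group)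
  obtain w' where "w' \<in> gwords X" "(w' @ w, []) \<in> word_eq X R"
    using gwords_left_inverse[OF w(1)] by blast
  then show ?case
    using w by (intro bexI[of _ "word_class X R w'"])
      (auto simp: carrier_presented_group mult_presented_group one_presented_group
        word_class_eq_iff)
next
  case (1 A B)
  then obtain u v where "u \<in> gwords X" "A = word_class X R u" "v \<in> gwords X" "B = word_class X R v"
    by (auto simp: carrier_presented_group)
  then show ?case by (simp add: carrier_presented_group mult_presented_group)
next
  case 2
  show ?case by (simp add: carrier_presented_group one_presented_group)
next
  case (3 A B C)
  then show ?case by (auto simp: carrier_presented_group mult_presented_group)
next
  case (4 A)
  then show ?case
    by (auto simp: carrier_presented_group mult_presented_group one_presented_group)
qed

lemma word_eval_closed:
  assumes "group G" "f \<in> X \<rightarrow> carrier G" "w \<in> gwords X"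
  shows "word_eval G f w \<in> carrier G"
proof -
  interpret group G by fact
  show ?thesis using assms(3,2) by (induction w) (auto simp: Pi_iff)
qed

lemma word_eval_append:
  assumes "group G" "f \<in> X \<rightarrow> carrier G" "u \<in> gwords X" "v \<in> gwords X"
  shows "word_eval G f (u @ v) = word_eval G f u \<otimes>\<^bsub>G\<^esub> word_eval G f v"
proof -
  interpret group G by fact
  have closed: "w \<in> gwords X \<Longrightarrow> word_eval G f w \<in> carrier G" for w
    using word_eval_closed[OF assms(1,2)] .
  show ?thesis using assms(3)
  proof (induction u)
    case Nil
    then show ?case using closed[OF assms(4)] by simp
  next
    case (Cons a u)
    obtain x b where a: "a = (x, b)" by fastforce
    have "f x \<in> carrier G" using Cons.prems assms(2) a by auto
    then show ?case
      using Cons closed[OF assms(4)] closed[of u] by (auto simp: a m_assoc)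
  qed
qed

lemma word_eval_cong:
  assumes "group G" "f \<in> X \<rightarrow> carrier G"
    and R: "\<And>u v. (u, v) \<in> R \<Longrightarrow> word_eval G f u = word_eval G f v"
    and "(u, v) \<in> word_eq X R"
  shows "word_eval G f u = word_eval G f v"
  using assms(4)
proof (induction rule: word_eq.induct)
  case (append u v u' v')
  then show ?case
    using word_eq_gwords[OF append(1)] word_eq_gwords[OF append(2)]
    by (simp add: word_eval_append[OF assms(1,2)])
next
  case (cancel x b)
  interpret group G by fact
  have "f x \<in> carrier G" using cancel assms(2) by auto
  then show ?case by simp
qed (auto simp: R)

lemma presented_hom_class:
  assumes "group G" "f \<in> X \<rightarrow> carrier G"
    and "\<And>u v. (u, v) \<in> R \<Longrightarrow> word_eval G f u = word_eval G f v"
    and "w \<in> gwords X"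
  shows "presented_hom G f (word_class X R w) = word_eval G f w"
proof -
  have "word_eval G f ` word_class X R w = {word_eval G f w}"
  proof (intro equalityI subsetI)
    fix y assume "y \<in> word_eval G f ` word_class X R w"
    then obtain v where "(w, v) \<in> word_eq X R" "y = word_eval G f v"
      by (auto simp: word_class_def)
    then show "y \<in> {word_eval G f w}"
      using word_eval_cong[OF assms(1-3)] by simp
  next
    fix y assume "y \<in> {word_eval G f w}"
    moreover have "w \<in> word_class X R w"
      using assms(4) by (simp add: word_class_def word_eq.refl)
    ultimately show "y \<in> word_eval G f ` word_class X R w" by simp
  qed
  then show ?thesis by (simp add: presented_hom_def)
qed

lemma presented_hom_hom:
  assumes "group G" "f \<in> X \<rightarrow> carrier G"
    and "\<And>u v. (u, v) \<in> R \<Longrightarrow> word_eval G f u = word_eval G f v"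
  shows "presented_hom G f \<in> hom (presented_group X R) G"
  by (rule homI)
    (auto simp: carrier_presented_group mult_presented_group presented_hom_class[OF assms]
      word_eval_closed[OF assms(1,2)] word_eval_append[OF assms(1,2)])


section \<open>Virtual braid groups\<close>

datatype vb_gen = Sg nat | Rh nat

abbreviation sg :: "nat \<Rightarrow> vb_gen \<times> bool" where "sg i \<equiv> (Sg i, True)"
abbreviation rh :: "nat \<Rightarrow> vb_gen \<times> bool" where "rh i \<equiv> (Rh i, True)"

definition VB_gens :: "nat \<Rightarrow> vb_gen set" where
  "VB_gens n = Sg ` {1..<n} \<union> Rh ` {1..<n}"

definition VB_rels :: "nat \<Rightarrow> (vb_gen gword \<times> vb_gen gword) set" where
  "VB_rels n =
     {([sg i, sg (i+1), sg i], [sg (i+1), sg i, sg (i+1)]) | i. 1 \<le> i \<and> i + 2 \<le> n}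
   \<union> {([rh i, rh (i+1), rh i], [rh (i+1), rh i, rh (i+1)]) | i. 1 \<le> i \<and> i + 2 \<le> n}
   \<union> {([rh i, rh (i+1), sg i], [sg (i+1), rh i, rh (i+1)]) | i. 1 \<le> i \<and> i + 2 \<le> n}
   \<union> {([rh i, rh i], []) | i. i \<in> {1..<n}}
   \<union> {([sg i, sg j], [sg j, sg i]) | i j. i \<in> {1..<n} \<and> j \<in> {1..<n} \<and> \<bar>int i - int j\<bar> \<ge> 2}
   \<union> {([rh i, rh j], [rh j, rh i]) | i j. i \<in> {1..<n} \<and> j \<in> {1..<n} \<and> \<bar>int i - int j\<bar> \<ge> 2}
   \<union> {([sg i, rh j], [rh j, sg i]) | i j. i \<in> {1..<n} \<and> j \<in> {1..<n} \<and> \<bar>int i - int j\<bar> \<ge> 2}"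

definition VB :: "nat \<Rightarrow> vb_gen gword set monoid" where
  "VB n = presented_group (VB_gens n) (VB_rels n)"

definition vb_gen_perm :: "vb_gen \<Rightarrow> nat \<Rightarrow> nat" where
  "vb_gen_perm g = (case g of Sg i \<Rightarrow> id | Rh i \<Rightarrow> transpose i (i+1))"

text \<open>\<^const>\<open>sym_group\<close> multiplies permutations as functions, right factor first. The opposite
  convention inverts every value of \<open>pi_K\<close>, as generators go to involutions or \<open>id\<close>, and
  so yields the same kernel.\<close>

definition pi_K :: "nat \<Rightarrow> vb_gen gword set \<Rightarrow> nat \<Rightarrow> nat" where
  "pi_K n = presented_hom (sym_group n) vb_gen_perm"

definition KB :: "nat \<Rightarrow> vb_gen gword set set" where
  "KB n = kernel (VB n) (sym_group n) (pi_K n)"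

lemma group_VB: "group (VB n)"
  by (simp add: VB_def group_presented_group)

lemma vb_gen_perm_closed: "vb_gen_perm \<in> VB_gens n \<rightarrow> carrier (sym_group n)"
  by (auto simp: VB_gens_def vb_gen_perm_def sym_group_carrier permutes_id
      intro!: permutes_swap_id)

lemma vb_gen_perm_rels:
  assumes "(u, v) \<in> VB_rels n"
  shows "word_eval (sym_group n) vb_gen_perm u = word_eval (sym_group n) vb_gen_perm v"
proof -
  have comm: "transpose i (Suc i) \<circ> transpose j (Suc j) = transpose j (Suc j) \<circ> transpose i (Suc i)"
    if "\<bar>int i - int j\<bar> \<ge> 2" for i j
  proof -
    have "i \<noteq> j" "i \<noteq> Suc j" "Suc i \<noteq> j" using that by auto
    then show ?thesis by (auto simp: fun_eq_iff transpose_def)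
  qed
  have braid: "transpose i (Suc i) \<circ> (transpose (Suc i) (Suc (Suc i)) \<circ> transpose i (Suc i)) =
      transpose (Suc i) (Suc (Suc i)) \<circ> (transpose i (Suc i) \<circ> transpose (Suc i) (Suc (Suc i)))" for i
    by (auto simp: fun_eq_iff transpose_def)
  show ?thesis
    using assms unfolding VB_rels_def
    by (elim UnE) (auto simp: sym_group_mult sym_group_one vb_gen_perm_def comm braid)
qed

lemma pi_K_hom: "pi_K n \<in> hom (VB n) (sym_group n)"
  unfolding pi_K_def VB_def
  by (rule presented_hom_hom[OF sym_group_is_group vb_gen_perm_closed vb_gen_perm_rels])

lemma pi_K_gens:
  assumes "i \<in> {1..<n}"
  shows "pi_K n (word_class (VB_gens n) (VB_rels n) [sg i]) = id"
    and "pi_K n (word_class (VB_gens n) (VB_rels n) [rh i]) = transpose i (i+1)"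
  unfolding pi_K_def using assms
  by (subst presented_hom_class[OF sym_group_is_group vb_gen_perm_closed vb_gen_perm_rels];
      simp add: VB_gens_def vb_gen_perm_def sym_group_mult sym_group_one)+

lemma KB_normal: "KB n \<lhd> VB n"
  unfolding KB_def
  by (intro group_hom.normal_kernel group_hom.intro group_hom_axioms.intro
      group_VB sym_group_is_group pi_K_hom)

lemma derived_KB_normal: "derived (VB n) (KB n) \<lhd> VB n"
  by (intro group.derived_is_normal group_VB KB_normal)


section \<open>Crystallographic groups\<close>

definition Z_power :: "nat \<Rightarrow> (nat \<Rightarrow> int) monoid" where
  "Z_power m = product_group {..<m} (\<lambda>_. integer_group)"

text \<open>\<open>\<theta>\<close> is the representation of \<open>F\<close> on \<open>Z_power m\<close> induced by conjugation in \<open>G\<close>: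
  an element of \<open>F\<close> acts through any lift of it along \<open>p\<close>.\<close>

definition crystallographic_extension ::
  "('a, 'c) monoid_scheme \<Rightarrow> nat \<Rightarrow> ('b, 'd) monoid_scheme \<Rightarrow>
   ((nat \<Rightarrow> int) \<Rightarrow> 'a) \<Rightarrow> ('a \<Rightarrow> 'b) \<Rightarrow> ('b \<Rightarrow> (nat \<Rightarrow> int) \<Rightarrow> (nat \<Rightarrow> int)) \<Rightarrow> bool" where
  "crystallographic_extension G m F \<iota> p \<theta> \<longleftrightarrow>
     group F \<and> finite (carrier F) \<and>
     \<iota> \<in> mon (Z_power m) G \<and> p \<in> epi G F \<and> \<iota> ` carrier (Z_power m) = kernel G F p \<and>
     \<theta> \<in> hom F (AutoGroup (Z_power m)) \<and>
     (\<forall>x\<in>carrier G. \<forall>z\<in>carrier (Z_power m).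
        \<iota> (\<theta> (p x) z) = x \<otimes>\<^bsub>G\<^esub> \<iota> z \<otimes>\<^bsub>G\<^esub> inv\<^bsub>G\<^esub> x) \<and>
     inj_on \<theta> (carrier F)"

text \<open>\<open>F\<close> is sought among groups whose elements are sets of elements of \<open>G\<close>, as for quotients
  of \<open>G\<close>. This is no restriction; see \<open>crystallographicI\<close>.\<close>

definition crystallographic :: "('a, 'c) monoid_scheme \<Rightarrow> bool" where
  "crystallographic G \<longleftrightarrow> group G \<and>
     (\<exists>m (F :: 'a set monoid) \<iota> p \<theta>. crystallographic_extension G m F \<iota> p \<theta>)"

lemma crystallographicI:
  fixes F :: "('b, 'd) monoid_scheme"
  assumes "group G" and ext: "crystallographic_extension G m F \<iota> p \<theta>"
  shows "crystallographic G"
proof -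
  have F: "group F" "finite (carrier F)"
    and \<iota>: "\<iota> \<in> mon (Z_power m) G" "\<iota> ` carrier (Z_power m) = kernel G F p"
    and p: "p \<in> hom G F" "p ` carrier G = carrier F"
    and \<theta>: "\<theta> \<in> hom F (AutoGroup (Z_power m))" "inj_on \<theta> (carrier F)"
    and conj: "\<And>x z. x \<in> carrier G \<Longrightarrow> z \<in> carrier (Z_power m) \<Longrightarrow>
        \<iota> (\<theta> (p x) z) = x \<otimes>\<^bsub>G\<^esub> \<iota> z \<otimes>\<^bsub>G\<^esub> inv\<^bsub>G\<^esub> x"
    using ext by (simp_all add: crystallographic_extension_def epi_def)
  interpret p: group_hom G F p
    using assms(1) F(1) p(1) by (simp add: group_hom_def group_hom_axioms_def)
  define K where "K = kernel G F p"
  define h where "h = (\<lambda>A. the_elem (p ` A))"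
  define q where "q = (\<lambda>x. K #>\<^bsub>G\<^esub> x)"
  interpret K: normal K G unfolding K_def by (rule p.normal_kernel)
  have h: "h \<in> iso (G Mod K) F"
    unfolding h_def K_def using p.FactGroup_iso_set[OF p(2)] .
  have hq: "h (q x) = p x" if x: "x \<in> carrier G" for x
  proof -
    have 1: "p y = p x" if y: "y \<in> q x" for y
    proof -
      obtain k where k: "k \<in> K" "y = k \<otimes>\<^bsub>G\<^esub> x"
        using y unfolding q_def r_coset_def by blast
      then have "k \<in> carrier G" "p k = \<one>\<^bsub>F\<^esub>" unfolding K_def kernel_def by simp_all
      then show ?thesis using k x by simp
    qed
    have 2: "x \<in> q x"
      unfolding q_def using x K.subgroup_axioms by (rule p.G.rcos_self)
    have "p ` q x = {p x}"
    proof (intro equalityI subsetI)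
      fix z assume "z \<in> p ` q x"
      then obtain y where "y \<in> q x" "z = p y" by (rule imageE) simp
      then show "z \<in> {p x}" using 1[of y] by simp
    next
      fix z assume "z \<in> {p x}"
      then show "z \<in> p ` q x" using imageI[OF 2, of p] by simp
    qed
    then show ?thesis unfolding h_def by (simp only: the_elem_eq)
  qed
  have fin: "finite (carrier (G Mod K))"
    using h F(2) bij_betw_finite unfolding iso_def by blast
  have q: "q \<in> epi G (G Mod K)"
    using K.r_coset_hom_Mod by (auto simp: q_def epi_def FactGroup_def RCOSETS_def)
  have ker: "kernel G (G Mod K) q = K"
  proof (intro equalityI subsetI)
    fix x assume "x \<in> kernel G (G Mod K) q"
    then show "x \<in> K"
      using p.G.coset_join1[of K x] K.subgroup_axioms by (simp add: kernel_def FactGroup_def q_def)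
  next
    fix x assume x: "x \<in> K"
    then have "x \<in> carrier G" using K.subset by blast
    then show "x \<in> kernel G (G Mod K) q"
      using x p.G.coset_join2[of x K] K.subgroup_axioms by (simp add: kernel_def FactGroup_def q_def)
  qed
  have \<theta>h: "\<theta> \<circ> h \<in> hom (G Mod K) (AutoGroup (Z_power m))"
    using h \<theta>(1) by (intro Group.hom_compose[of h _ F]) (simp_all add: iso_def)
  have inj: "inj_on (\<theta> \<circ> h) (carrier (G Mod K))"
    using h \<theta>(2) by (intro comp_inj_on) (simp_all add: iso_def bij_betw_def)
  have "crystallographic_extension G m (G Mod K) \<iota> q (\<theta> \<circ> h)"
    unfolding crystallographic_extension_def
    using K.factorgroup_is_group fin \<iota>(1) q \<iota>(2)[folded K_def] ker \<theta>h inj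
    by (simp add: hq conj)
  with assms(1) show ?thesis
    unfolding crystallographic_def by (intro conjI exI)
qed

end

theory Submission
  imports Defs "HOL-Algebra.Multiplicative_Group"
begin

text \<open>
  Let \<open>G\<close> be the quotient of \<open>VB n\<close> by the commutator subgroup of \<open>KB n\<close>, and \<open>K\<close> the image of
  \<open>KB n\<close> in \<open>G\<close>, an abelian normal subgroup with quotient the symmetric group.

  Since the images of the \<open>\<sigma>\<^sub>i\<close> lie in \<open>K\<close>, they commute, and the braid relation makes them all
  equal to a single element \<open>\<sigma>\<close>. The mixed relation then says that \<open>\<rho>\<^sub>i\<rho>\<^sub>i\<^sub>+\<^sub>1\<close> centralizes \<open>\<sigma>\<close>, so
  every \<open>\<rho>\<^sub>i\<close> conjugates \<open>\<sigma>\<close> to the same element \<open>\<sigma>'\<close>, and vice versa. Hence each element of \<open>G\<close> is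
  a product of a power of \<open>\<sigma>\<close>, a power of \<open>\<sigma>'\<close> and an element of the subgroup generated by the
  \<open>\<rho>\<^sub>i\<close>. The latter subgroup maps injectively to the symmetric group, by the Coxeter presentation
  (\<open>coxeter_presentation_faithful\<close>), and so \<open>K\<close> is generated by \<open>\<sigma>\<close> and \<open>\<sigma>'\<close>
  (\<open>kernel_normal_form\<close>).

  For \<open>n \<ge> 3\<close> both factors of \<open>\<rho>\<^sub>1\<rho>\<^sub>2\<close> exchange \<open>\<sigma>\<close> and \<open>\<sigma>'\<close>, so this is a nontrivial torsion element
  centralizing the finite-index subgroup \<open>K\<close>. In a crystallographic group such an element would
  act trivially on the lattice, hence belong to it, but the lattice is torsion-free
  (\<open>crystallographic_torsion_centralizing_kernel_trivial\<close>).

  For \<open>n = 2\<close> the two generators of \<open>K\<close> are independent, as is seen from the action on the plane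
  lattice in which \<open>\<sigma>\<close> is a unit translation and \<open>\<rho>\<^sub>1\<close> exchanges the coordinates. So \<open>K\<close> is free
  abelian of rank 2 and the symmetric group acts faithfully by that exchange
  (\<open>crystallographic_if_plane_action\<close>).
\<close>

section \<open>An obstruction to being crystallographic\<close>

lemma group_Z_power: "group (Z_power m)"
  by (simp add: Z_power_def)

lemma Z_power_nat_pow:
  assumes "z \<in> carrier (Z_power m)"
  shows "z [^]\<^bsub>Z_power m\<^esub> (k::nat) = (\<lambda>i\<in>{..<m}. int k * z i)"
proof (induction k)
  case 0
  show ?case by (simp add: Z_power_def nat_pow_def)
next
  case (Suc k)
  interpret group "Z_power m" by (rule group_Z_power)
  have "z [^]\<^bsub>Z_power m\<^esub> Suc k = z [^]\<^bsub>Z_power m\<^esub> k \<otimes>\<^bsub>Z_power m\<^esub> z" by simp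
  then show ?case unfolding Suc.IH by (auto simp: Z_power_def fun_eq_iff algebra_simps)
qed

text \<open>In the proof below only a power of a lattice vector is known to be fixed by conjugation;
  uniqueness of roots recovers the vector itself. With root \<open>1\<close> this is torsion-freeness.\<close>

lemma Z_power_root_unique:
  assumes z: "z \<in> carrier (Z_power m)" and w: "w \<in> carrier (Z_power m)" and k: "(k::nat) > 0"
    and eq: "z [^]\<^bsub>Z_power m\<^esub> k = w [^]\<^bsub>Z_power m\<^esub> k"
  shows "z = w"
proof
  fix i
  have zw: "z \<in> extensional {..<m}" "w \<in> extensional {..<m}"
    using z w by (auto simp: Z_power_def PiE_def)
  show "z i = w i"
  proof (cases "i < m")
    case True
    with fun_cong[OF eq, of i] k show ?thesis by (simp add: Z_power_nat_pow z w)
  next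
    case False
    with zw show ?thesis by (simp add: extensional_def)
  qed
qed

text \<open>The obstruction to being crystallographic. Each lattice vector has a power in the kernel of
  \<open>h\<close>, because \<open>H\<close> is finite, and \<open>t\<close> fixes that power, hence the vector. So \<open>t\<close> acts trivially
  on the lattice; by faithfulness it lies in the lattice, which is torsion-free.\<close>

lemma crystallographic_torsion_centralizing_kernel_trivial:
  assumes cr: "crystallographic G" and h: "group_hom G H h" and fin: "finite (carrier H)"
    and t: "t \<in> carrier G" "t [^]\<^bsub>G\<^esub> (k::nat) = \<one>\<^bsub>G\<^esub>" "k > 0"
    and comm: "\<And>x. x \<in> kernel G H h \<Longrightarrow> t \<otimes>\<^bsub>G\<^esub> x = x \<otimes>\<^bsub>G\<^esub> t"
  shows "t = \<one>\<^bsub>G\<^esub>"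
proof -
  interpret h: group_hom G H h by fact
  from cr obtain m and F :: "'a set monoid" and \<iota> p \<theta>
    where "crystallographic_extension G m F \<iota> p \<theta>"
    unfolding crystallographic_def by blast
  then have F: "group F"
    and \<iota>: "\<iota> \<in> hom (Z_power m) G" "inj_on \<iota> (carrier (Z_power m))"
      "\<iota> ` carrier (Z_power m) = kernel G F p"
    and p: "p \<in> hom G F"
    and \<theta>: "\<theta> \<in> hom F (AutoGroup (Z_power m))" "inj_on \<theta> (carrier F)"
    and conj: "\<And>x z. x \<in> carrier G \<Longrightarrow> z \<in> carrier (Z_power m) \<Longrightarrow>
        \<iota> (\<theta> (p x) z) = x \<otimes>\<^bsub>G\<^esub> \<iota> z \<otimes>\<^bsub>G\<^esub> inv\<^bsub>G\<^esub> x"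
    by (simp_all add: crystallographic_extension_def epi_def mon_def)
  interpret Z: group "Z_power m" by (rule group_Z_power)
  interpret p: group_hom G F p
    using F p by (simp add: group_hom_def group_hom_axioms_def)
  interpret \<iota>: group_hom "Z_power m" G \<iota>
    using \<iota> by (simp add: group_hom_def group_hom_axioms_def Z.group_axioms)
  interpret \<theta>: group_hom F "AutoGroup (Z_power m)" \<theta>
    using F \<theta> by (simp add: group_hom_def group_hom_axioms_def Z.AutoGroup)
  define N where "N = order H"
  have N: "N > 0" using fin h.H.one_closed by (auto simp: N_def order_def card_gt_0_iff)
  have pt: "p t \<in> carrier F" using t by simp
  have aut: "\<theta> (p t) \<in> auto (Z_power m)"
    using \<theta>.hom_closed[OF pt] by (simp add: AutoGroup_def)
  then interpret aut: group_hom "Z_power m" "Z_power m" "\<theta> (p t)"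
    by (simp add: auto_def group_hom_def group_hom_axioms_def Z.group_axioms)
  have fixed: "\<theta> (p t) z = z" if z: "z \<in> carrier (Z_power m)" for z
  proof -
    let ?a = "\<iota> z [^]\<^bsub>G\<^esub> N"
    have a: "?a \<in> kernel G H h"
      using z h.H.pow_order_eq_1[of "h (\<iota> z)"]
      by (simp add: kernel_def h.hom_nat_pow N_def)
    have zN: "z [^]\<^bsub>Z_power m\<^esub> N \<in> carrier (Z_power m)" using z by simp
    have "\<iota> (\<theta> (p t) (z [^]\<^bsub>Z_power m\<^esub> N)) = t \<otimes>\<^bsub>G\<^esub> ?a \<otimes>\<^bsub>G\<^esub> inv\<^bsub>G\<^esub> t"
      using conj[OF t(1), of "z [^]\<^bsub>Z_power m\<^esub> N"] z by (simp add: \<iota>.hom_nat_pow)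
    also have "\<dots> = ?a \<otimes>\<^bsub>G\<^esub> t \<otimes>\<^bsub>G\<^esub> inv\<^bsub>G\<^esub> t" by (simp only: comm[OF a])
    also have "\<dots> = \<iota> (z [^]\<^bsub>Z_power m\<^esub> N)"
      using z t by (simp add: h.G.m_assoc \<iota>.hom_nat_pow)
    finally have "\<theta> (p t) (z [^]\<^bsub>Z_power m\<^esub> N) = z [^]\<^bsub>Z_power m\<^esub> N"
      using inj_onD[OF \<iota>(2) _ aut.hom_closed[OF zN] zN] by blast
    then show ?thesis
      using z N by (intro Z_power_root_unique[of _ m z N]) (simp_all add: aut.hom_nat_pow)
  qed
  have "\<theta> (p t) = \<theta> \<one>\<^bsub>F\<^esub>"
  proof
    fix z
    have "\<theta> \<one>\<^bsub>F\<^esub> = (\<lambda>z\<in>carrier (Z_power m). z)"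
      using \<theta>.hom_one by (simp add: AutoGroup_def BijGroup_def)
    moreover have "\<theta> (p t) \<in> extensional (carrier (Z_power m))"
      using aut by (simp add: auto_def Bij_def)
    ultimately show "\<theta> (p t) z = \<theta> \<one>\<^bsub>F\<^esub> z"
      using fixed by (auto simp: extensional_def)
  qed
  then have "p t = \<one>\<^bsub>F\<^esub>" using inj_onD[OF \<theta>(2) _ pt] by simp
  then have "t \<in> \<iota> ` carrier (Z_power m)" using t \<iota>(3) by (simp add: kernel_def)
  then obtain z where z: "z \<in> carrier (Z_power m)" "t = \<iota> z" by blast
  have "\<iota> (z [^]\<^bsub>Z_power m\<^esub> k) = \<iota> \<one>\<^bsub>Z_power m\<^esub>"
    using z t by (simp add: \<iota>.hom_nat_pow)
  then have "z [^]\<^bsub>Z_power m\<^esub> k = \<one>\<^bsub>Z_power m\<^esub> [^]\<^bsub>Z_power m\<^esub> k"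
    using inj_onD[OF \<iota>(2), of "z [^]\<^bsub>Z_power m\<^esub> k" "\<one>\<^bsub>Z_power m\<^esub>"] z by simp
  then have "z = \<one>\<^bsub>Z_power m\<^esub>"
    by (rule Z_power_root_unique[OF z(1) Z.one_closed t(3)])
  then show ?thesis using z by simp
qed


section \<open>The Coxeter presentation of the symmetric group\<close>

text \<open>Involutions satisfying the braid and far commutation relations, together with a
  homomorphism that sends them to the adjacent transpositions. The homomorphism is part of the
  locale because it separates the normal forms constructed below.\<close>

locale symmetric_generators = group_hom G "sym_group n" h
  for G :: "('a, 'b) monoid_scheme" (structure) and n :: nat and h +
  fixes r :: "nat \<Rightarrow> 'a"
  assumes r_closed: "i \<in> {1..<n} \<Longrightarrow> r i \<in> carrier G"
    and h_r: "i \<in> {1..<n} \<Longrightarrow> h (r i) = transpose i (i + 1)"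
    and r_square: "i \<in> {1..<n} \<Longrightarrow> r i \<otimes> r i = \<one>"
    and r_braid: "1 \<le> i \<Longrightarrow> i + 2 \<le> n \<Longrightarrow>
      r i \<otimes> r (i + 1) \<otimes> r i = r (i + 1) \<otimes> r i \<otimes> r (i + 1)"
    and r_commute: "i \<in> {1..<n} \<Longrightarrow> j \<in> {1..<n} \<Longrightarrow> i + 2 \<le> j \<Longrightarrow> r i \<otimes> r j = r j \<otimes> r i"
begin

lemma inv_r: "i \<in> {1..<n} \<Longrightarrow> inv (r i) = r i"
  using r_closed r_square by (intro G.inv_equality) auto

lemma r_cancel: "i \<in> {1..<n} \<Longrightarrow> x \<in> carrier G \<Longrightarrow> r i \<otimes> (r i \<otimes> x) = x"
  using r_closed r_square by (simp flip: G.m_assoc)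

text \<open>The product \<open>r k \<otimes> r (k - 1) \<otimes> \<dots> \<otimes> r j\<close>, which is empty for \<open>j = k + 1\<close>. For
  \<open>1 \<le> j \<le> k + 1\<close> these represent the right cosets of the
  subgroup generated by \<open>r 1, \<dots>, r (k - 1)\<close> in the one generated by \<open>r 1, \<dots>, r k\<close>.\<close>

primrec descending :: "nat \<Rightarrow> nat \<Rightarrow> 'a" where
  "descending j 0 = \<one>"
| "descending j (Suc k) = (if j \<le> Suc k then r (Suc k) \<otimes> descending j k else \<one>)"

lemma descending_closed: "1 \<le> j \<Longrightarrow> k < n \<Longrightarrow> descending j k \<in> carrier G"
  by (induction k) (auto simp: r_closed)

lemma descending_empty: "k < j \<Longrightarrow> descending j k = \<one>"
  by (cases k) auto

lemma descending_extend:
  assumes "1 \<le> i" "i \<le> k" "k < n"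
  shows "descending (Suc i) k \<otimes> r i = descending i k"
  using assms(2,3)
proof (induction k rule: dec_induct)
  case base
  then have "r i \<in> carrier G" using assms(1) by (intro r_closed) auto
  then show ?case
    using assms(1) by (cases i) (auto simp: descending_empty)
next
  case (step k)
  have "r i \<in> carrier G" "r (Suc k) \<in> carrier G" "descending (Suc i) k \<in> carrier G"
    using assms(1) step by (auto intro!: r_closed descending_closed)
  then show ?case using step by (simp add: G.m_assoc)
qed

lemma r_commute_descending:
  assumes "i \<in> {1..<n}" "1 \<le> j" "k < n"
    and "\<And>l. j \<le> l \<Longrightarrow> l \<le> k \<Longrightarrow> i + 2 \<le> l \<or> l + 2 \<le> i"
  shows "descending j k \<otimes> r i = r i \<otimes> descending j k"
  using assms(3,4)
proof (induction k)
  case 0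
  then show ?case using assms by (simp add: r_closed)
next
  case (Suc k)
  have c: "r i \<in> carrier G" "r (Suc k) \<in> carrier G" "descending j k \<in> carrier G"
    using assms Suc.prems by (auto intro!: r_closed descending_closed)
  have IH: "descending j k \<otimes> r i = r i \<otimes> descending j k"
    using Suc by simp
  show ?case
  proof (cases "j \<le> Suc k")
    case True
    then have "r (Suc k) \<otimes> r i = r i \<otimes> r (Suc k)"
      using Suc.prems(2)[of "Suc k"] Suc.prems(1) assms(1) r_commute[of i "Suc k"]
        r_commute[of "Suc k" i] by auto
    then show ?thesis using True c IH by (simp add: G.m_assoc) (simp flip: G.m_assoc)
  qed (use c in simp)
qed

text \<open>Here \<open>r i\<close> moves left through the smaller factors, meets the consecutive pair
  \<open>r i \<otimes> r (i - 1)\<close>, becomes \<open>r (i - 1)\<close> by the braid relation, and then commutes with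
  the larger factors.\<close>

lemma r_shift_descending:
  assumes "1 \<le> j" "j < i" "i \<le> k" "k < n"
  shows "descending j k \<otimes> r i = r (i - 1) \<otimes> descending j k"
  using assms(3,4)
proof (induction k rule: dec_induct)
  case base
  obtain l where i: "i = Suc (Suc l)"
    using assms less_imp_Suc_add[of j i] by (cases j) auto
  have c: "r (Suc l) \<in> carrier G" "r i \<in> carrier G" "descending j l \<in> carrier G"
    using assms base i by (auto intro!: r_closed descending_closed)
  have com: "descending j l \<otimes> r i = r i \<otimes> descending j l"
    using assms base i by (intro r_commute_descending) auto
  have br: "r (Suc l) \<otimes> r i \<otimes> r (Suc l) = r i \<otimes> r (Suc l) \<otimes> r i"
    using r_braid[of "Suc l"] i base by simp
  have "descending j i \<otimes> r i = (r i \<otimes> r (Suc l) \<otimes> r i) \<otimes> descending j l"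
    using c com assms i by (simp add: G.m_assoc)
  also have "\<dots> = (r (Suc l) \<otimes> r i \<otimes> r (Suc l)) \<otimes> descending j l"
    by (simp only: br)
  also have "\<dots> = r (i - 1) \<otimes> descending j i"
    using c assms i by (simp add: G.m_assoc)
  finally show ?case .
next
  case (step k)
  have c: "r i \<in> carrier G" "r (i - 1) \<in> carrier G" "r (Suc k) \<in> carrier G" "descending j k \<in> carrier G"
    using assms step by (auto intro!: r_closed descending_closed)
  have com: "r (i - 1) \<otimes> r (Suc k) = r (Suc k) \<otimes> r (i - 1)"
    using assms step by (intro r_commute) auto
  have "descending j (Suc k) \<otimes> r i = (r (Suc k) \<otimes> r (i - 1)) \<otimes> descending j k"
    using c step assms by (simp add: G.m_assoc)
  also have "\<dots> = (r (i - 1) \<otimes> r (Suc k)) \<otimes> descending j k"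
    by (simp only: com)
  also have "\<dots> = r (i - 1) \<otimes> descending j (Suc k)"
    using c step assms by (simp add: G.m_assoc)
  finally show ?case .
qed

text \<open>The coset representatives are closed under right multiplication by a generator, up to a
  factor from the smaller subgroup: the index \<open>j\<close> moves by one if \<open>i\<close> is \<open>j - 1\<close> or \<open>j\<close>, and
  otherwise a generator passes to the left.\<close>

lemma descending_mult_r:
  assumes "i \<in> {1..k}" "j \<in> {1..Suc k}" "k < n"
  shows "\<exists>u\<in>generate G (r ` {1..<k}). \<exists>j'\<in>{1..Suc k}. descending j k \<otimes> r i = u \<otimes> descending j' k"
proof -
  have c: "descending l k \<in> carrier G" if "1 \<le> l" for l
    using that assms by (simp add: descending_closed)
  have ri: "i \<in> {1..<n}" "r i \<in> carrier G" using assms by (auto intro!: r_closed)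
  consider "j = Suc i" | "j = i" | "Suc i < j" | "j < i" by linarith
  then show ?thesis
  proof cases
    case 1
    then have "descending j k \<otimes> r i = \<one> \<otimes> descending i k"
      using assms c by (simp add: descending_extend)
    moreover have "i \<in> {1..Suc k}" using assms by simp
    ultimately show ?thesis by (intro bexI[OF _ generate.one] bexI[of _ i])
  next
    case 2
    have "descending i k \<otimes> r i = descending (Suc i) k \<otimes> r i \<otimes> r i"
      using assms by (simp add: descending_extend)
    also have "\<dots> = \<one> \<otimes> descending (Suc i) k"
      using ri c[of "Suc i"] by (simp add: G.m_assoc r_square)
    finally have "descending j k \<otimes> r i = \<one> \<otimes> descending (Suc i) k" using 2 by simp
    moreover have "Suc i \<in> {1..Suc k}" using assms by simp
    ultimately show ?thesis by (intro bexI[OF _ generate.one] bexI[of _ "Suc i"])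
  next
    case 3
    then have "descending j k \<otimes> r i = r i \<otimes> descending j k"
      using assms ri by (intro r_commute_descending) auto
    moreover have "r i \<in> generate G (r ` {1..<k})"
      using assms 3 by (intro generate.incl imageI) auto
    ultimately show ?thesis using assms(2) by (intro bexI)
  next
    case 4
    then have "descending j k \<otimes> r i = r (i - 1) \<otimes> descending j k"
      using assms by (intro r_shift_descending) auto
    moreover have "r (i - 1) \<in> generate G (r ` {1..<k})"
      using assms 4 by (intro generate.incl imageI) auto
    ultimately show ?thesis using assms(2) by (intro bexI)
  qed
qed

lemma generate_r_closed: "k \<le> n \<Longrightarrow> x \<in> generate G (r ` {1..<k}) \<Longrightarrow> x \<in> carrier G"
  by (rule G.generate_in_carrier[of "r ` {1..<k}"]) (auto intro!: r_closed)

lemma generate_r_normal_form: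
  assumes "x \<in> generate G (r ` {1..<Suc k})" "k < n"
  shows "\<exists>u\<in>generate G (r ` {1..<k}). \<exists>j\<in>{1..Suc k}. x = u \<otimes> descending j k"
proof -
  define T where "T = {u \<otimes> descending j k | u j. u \<in> generate G (r ` {1..<k}) \<and> j \<in> {1..Suc k}}"
  have T_carrier: "y \<in> carrier G" if "y \<in> T" for y
    using that assms(2) generate_r_closed[of k] by (auto simp: T_def intro!: descending_closed)
  have step: "y \<otimes> r i \<in> T" if y: "y \<in> T" and i: "i \<in> {1..<Suc k}" for y i
  proof -
    obtain u j where uj: "y = u \<otimes> descending j k" "u \<in> generate G (r ` {1..<k})" "j \<in> {1..Suc k}"
      using y by (auto simp: T_def)
    obtain v j' where v: "v \<in> generate G (r ` {1..<k})" "j' \<in> {1..Suc k}"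
        "descending j k \<otimes> r i = v \<otimes> descending j' k"
      using descending_mult_r[of i k j] i uj assms by auto
    have "y \<otimes> r i = (u \<otimes> v) \<otimes> descending j' k"
      using uj v i assms generate_r_closed[of k]
      by (simp add: G.m_assoc r_closed descending_closed)
    moreover have "u \<otimes> v \<in> generate G (r ` {1..<k})" by (intro generate.eng uj v)
    ultimately show ?thesis unfolding T_def using v(2) by blast
  qed
  have "y \<otimes> x \<in> T" if "y \<in> T" for y
    using assms(1) that
  proof (induction x arbitrary: y rule: generate.induct)
    case one
    then show ?case using T_carrier[OF one.prems] by simp
  next
    case (incl h)
    then show ?case using step by blast
  next
    case (inv h)
    then obtain i where "i \<in> {1..<Suc k}" "h = r i" by blast
    then show ?case using step[OF inv.prems] inv_r[of i] assms(2) by simp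
  next
    case (eng h1 h2)
    then have "y \<otimes> (h1 \<otimes> h2) = (y \<otimes> h1) \<otimes> h2"
      using T_carrier[OF eng.prems] generate_r_closed[of "Suc k"] assms(2) by (simp add: G.m_assoc)
    then show ?case using eng by simp
  qed
  moreover have "\<one> \<otimes> descending (Suc k) k \<in> T"
    unfolding T_def using generate.one[of G] by fastforce
  ultimately have "\<one> \<otimes> x \<in> T" by (simp add: descending_empty)
  then have "x \<in> T" using assms generate_r_closed[of "Suc k"] by simp
  then show ?thesis unfolding T_def by blast
qed

text \<open>With \<open>h_generate_fixes\<close> below, this makes the permutation determine the coset: it sends
  \<open>j\<close> to \<open>k + 1\<close> when the coset representative is \<open>descending j k\<close>.\<close>

lemma h_descending:
  "1 \<le> j \<Longrightarrow> j \<le> Suc k \<Longrightarrow> k < n \<Longrightarrow> h (descending j k) j = Suc k"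
proof (induction k)
  case 0
  then show ?case using hom_one by (simp add: sym_group_one)
next
  case (Suc k)
  show ?case
  proof (cases "j = Suc (Suc k)")
    case True
    then show ?thesis using hom_one by (simp add: sym_group_one)
  next
    case False
    then show ?thesis using Suc
      by (simp add: sym_group_mult r_closed descending_closed h_r)
  qed
qed

lemma h_generate_fixes:
  assumes "u \<in> generate G (r ` {1..<k})" "k < n"
  shows "h u (Suc k) = Suc k"
  using assms(1)
proof (induction rule: generate.induct)
  case one
  then show ?case using hom_one by (simp add: sym_group_one)
next
  case (incl x)
  then show ?case using assms(2) by (auto simp: h_r transpose_def)
next
  case (inv x)
  then show ?case using assms(2) by (auto simp: inv_r h_r transpose_def)
next
  case (eng x y)
  then show ?case using assms(2) generate_r_closed[of k] by (simp add: sym_group_mult)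
qed

text \<open>The relations of \<open>symmetric_generators\<close> present the symmetric group. If \<open>h x = id\<close>, then the
  last coset representative in the normal form of \<open>x\<close> fixes its index and hence is empty, so \<open>x\<close>
  lies in the subgroup generated by one generator fewer,
  and induction applies.\<close>

theorem coxeter_presentation_faithful:
  assumes "x \<in> generate G (r ` {1..<n})" "h x = id"
  shows "x = \<one>"
proof -
  have *: "x = \<one>" if "x \<in> generate G (r ` {1..<Suc k})" "h x = id" "k < n" for x k
    using that
  proof (induction k arbitrary: x)
    case 0
    then show ?case by (simp add: G.generate_empty)
  next
    case (Suc k)
    then obtain u j where uj: "u \<in> generate G (r ` {1..<Suc k})" "j \<in> {1..Suc (Suc k)}"
        "x = u \<otimes> descending j (Suc k)"
      using generate_r_normal_form[of x "Suc k"] by blast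
    have c: "u \<in> carrier G" "descending j (Suc k) \<in> carrier G"
      using uj Suc.prems generate_r_closed[of "Suc k"] descending_closed[of j "Suc k"] by auto
    \<comment> \<open>The image of \<open>j\<close> under \<open>h x\<close> is computed once from \<open>h x = id\<close> and once from the normal form.\<close>
    have "j = h x j" using Suc.prems by simp
    also have "\<dots> = h u (h (descending j (Suc k)) j)"
      using uj c by (simp add: sym_group_mult del: descending.simps)
    also have "\<dots> = Suc (Suc k)"
      using uj Suc.prems h_generate_fixes[of u "Suc k"] h_descending[of j "Suc k"] by simp
    finally have "x = u" using uj c by simp
    then show ?case using Suc uj by simp
  qed
  then show ?thesis
  proof (cases n)
    case 0
    then show ?thesis using assms by (simp add: G.generate_empty)
  next
    case (Suc k)
    then show ?thesis using assms * by blast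
  qed
qed

end

section \<open>Quotients of virtual braid groups with abelian kernel\<close>

lemma (in group) conj_int_pow:
  assumes "a \<in> carrier G" "x \<in> carrier G"
  shows "a \<otimes> x [^] (k::int) \<otimes> inv a = (a \<otimes> x \<otimes> inv a) [^] k"
proof -
  have "(\<lambda>x. a \<otimes> x \<otimes> inv a) \<in> hom G G"
    using assms(1) by (intro homI) (auto simp: m_assoc inv_solve_left)
  then interpret c: group_hom G G "\<lambda>x. a \<otimes> x \<otimes> inv a"
    by unfold_locales
  show ?thesis using c.hom_int_pow[OF assms(2)] .
qed

text \<open>The features of \<open>VB n Mod derived (VB n) (KB n)\<close> that matter below: it is generated by
  images \<open>r i\<close>, \<open>s i\<close> of the generators, and the kernel of its map to the symmetric group is
  abelian.\<close>

locale virtual_braid_image = symmetric_generators G n h r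
  for G :: "('a, 'b) monoid_scheme" (structure) and n h r +
  fixes s :: "nat \<Rightarrow> 'a"
  assumes n_ge_2: "2 \<le> n"
    and s_closed: "i \<in> {1..<n} \<Longrightarrow> s i \<in> carrier G"
    and h_s: "i \<in> {1..<n} \<Longrightarrow> h (s i) = id"
    and s_braid: "1 \<le> i \<Longrightarrow> i + 2 \<le> n \<Longrightarrow>
      s i \<otimes> s (i + 1) \<otimes> s i = s (i + 1) \<otimes> s i \<otimes> s (i + 1)"
    and mixed: "1 \<le> i \<Longrightarrow> i + 2 \<le> n \<Longrightarrow>
      r i \<otimes> r (i + 1) \<otimes> s i = s (i + 1) \<otimes> r i \<otimes> r (i + 1)"
    and generated: "carrier G = generate G (s ` {1..<n} \<union> r ` {1..<n})"
    and kernel_commute: "x \<in> kernel G (sym_group n) h \<Longrightarrow> y \<in> kernel G (sym_group n) h \<Longrightarrow>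
      x \<otimes> y = y \<otimes> x"
begin

definition \<sigma> where "\<sigma> = s 1"
definition \<sigma>' where "\<sigma>' = r 1 \<otimes> \<sigma> \<otimes> r 1"

text \<open>Elements of the kernel in additive coordinates with respect to \<open>\<sigma>\<close> and \<open>\<sigma>'\<close>.\<close>

definition vec :: "int \<Rightarrow> int \<Rightarrow> 'a" where "vec a b = \<sigma> [^] a \<otimes> \<sigma>' [^] b"

lemma s_kernel: "i \<in> {1..<n} \<Longrightarrow> s i \<in> kernel G (sym_group n) h"
  by (simp add: kernel_def s_closed h_s sym_group_one)

text \<open>Two commuting elements that satisfy the braid relation are equal.\<close>

lemma s_eq: "i \<in> {1..<n} \<Longrightarrow> s i = \<sigma>"
proof (induction i)
  case (Suc i)
  show ?case
  proof (cases "i = 0")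
    case False
    then have i: "i \<in> {1..<n}" using Suc.prems by auto
    note c = s_closed[OF i] s_closed[OF Suc.prems]
    have com: "s (Suc i) \<otimes> s i = s i \<otimes> s (Suc i)"
      by (intro kernel_commute s_kernel i Suc.prems)
    have "s i \<otimes> (s i \<otimes> s (Suc i)) = s i \<otimes> (s (Suc i) \<otimes> s (Suc i))"
      using s_braid[of i] i Suc.prems c com by (simp add: G.m_assoc)
    then show ?thesis using c Suc.IH[OF i] by simp
  qed (simp add: \<sigma>_def)
qed simp

lemma r1: "r 1 \<in> carrier G" "1 \<in> {1..<n}"
  using n_ge_2 by (auto intro!: r_closed)

lemma \<sigma>_closed: "\<sigma> \<in> carrier G" "\<sigma>' \<in> carrier G"
  using s_closed[of 1] r1 by (auto simp: \<sigma>_def \<sigma>'_def)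

lemma \<sigma>_kernel: "\<sigma> \<in> kernel G (sym_group n) h" "\<sigma>' \<in> kernel G (sym_group n) h"
proof -
  have "h \<sigma> = id" using h_s[OF r1(2)] by (simp add: \<sigma>_def)
  moreover from this have "h \<sigma>' = id"
    using r1 h_r[OF r1(2)] \<sigma>_closed by (simp add: \<sigma>'_def sym_group_mult)
  ultimately show "\<sigma> \<in> kernel G (sym_group n) h" "\<sigma>' \<in> kernel G (sym_group n) h"
    using \<sigma>_closed by (simp_all add: kernel_def sym_group_one)
qed

text \<open>Since all \<open>s i\<close> are \<open>\<sigma>\<close>, the mixed relation says that \<open>r i \<otimes> r (i + 1)\<close> commutes with \<open>\<sigma>\<close>, so
  that \<open>r i\<close> and \<open>r (i + 1)\<close> conjugate \<open>\<sigma>\<close> to the same element.\<close>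

lemma r_conj_\<sigma>: "i \<in> {1..<n} \<Longrightarrow> r i \<otimes> \<sigma> \<otimes> r i = \<sigma>'"
proof (induction i)
  case (Suc i)
  show ?case
  proof (cases "i = 0")
    case False
    then have i: "i \<in> {1..<n}" "1 \<le> i" "i + 2 \<le> n" using Suc.prems by auto
    note c = r_closed[OF i(1)] r_closed[OF Suc.prems] \<sigma>_closed
    have m: "r i \<otimes> r (Suc i) \<otimes> \<sigma> = \<sigma> \<otimes> r i \<otimes> r (Suc i)"
      using mixed[OF i(2,3)] s_eq[OF i(1)] s_eq[OF Suc.prems] by simp
    have "r (Suc i) \<otimes> \<sigma> \<otimes> r (Suc i) = r i \<otimes> (r i \<otimes> r (Suc i) \<otimes> \<sigma>) \<otimes> r (Suc i)"
      using c i Suc.prems by (simp add: G.m_assoc r_cancel)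
    also have "\<dots> = r i \<otimes> (\<sigma> \<otimes> r i \<otimes> r (Suc i)) \<otimes> r (Suc i)" by (simp only: m)
    also have "\<dots> = r i \<otimes> \<sigma> \<otimes> r i"
      using c Suc.prems by (simp add: G.m_assoc r_square)
    finally show ?thesis using Suc.IH[OF i(1)] by simp
  qed (simp add: \<sigma>'_def)
qed simp

lemma r_conj_\<sigma>': "i \<in> {1..<n} \<Longrightarrow> r i \<otimes> \<sigma>' \<otimes> r i = \<sigma>"
  using r_closed[of i] \<sigma>_closed
  by (simp add: G.m_assoc r_cancel r_square flip: r_conj_\<sigma>)

lemma vec_closed: "vec a b \<in> carrier G"
  by (simp add: vec_def \<sigma>_closed)

lemma vec_kernel: "vec a b \<in> kernel G (sym_group n) h"
proof -
  have K: "subgroup (kernel G (sym_group n) h) G" by (rule subgroup_kernel)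
  have "x [^] (k::int) \<in> kernel G (sym_group n) h" if "x \<in> kernel G (sym_group n) h" for x k
    using G.subgroup_int_pow_closed[OF K that] .
  then show ?thesis unfolding vec_def using K \<sigma>_kernel by (simp add: subgroup.m_closed)
qed

lemma vec_mult: "vec a b \<otimes> vec c d = vec (a + c) (b + d)"
proof -
  have pow: "\<sigma> [^] k = vec k 0" "\<sigma>' [^] k = vec 0 k" for k
    by (simp_all add: vec_def \<sigma>_closed)
  have com: "\<sigma>' [^] b \<otimes> \<sigma> [^] c = \<sigma> [^] c \<otimes> \<sigma>' [^] b"
    unfolding pow by (intro kernel_commute vec_kernel)
  have "vec a b \<otimes> vec c d = \<sigma> [^] a \<otimes> (\<sigma>' [^] b \<otimes> \<sigma> [^] c) \<otimes> \<sigma>' [^] d"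
    by (simp add: vec_def G.m_assoc \<sigma>_closed)
  also have "\<dots> = \<sigma> [^] a \<otimes> (\<sigma> [^] c \<otimes> \<sigma>' [^] b) \<otimes> \<sigma>' [^] d"
    by (simp only: com)
  also have "\<dots> = vec (a + c) (b + d)"
    by (simp add: vec_def G.int_pow_mult \<sigma>_closed G.m_assoc)
  finally show ?thesis .
qed

lemma r_vec:
  assumes i: "i \<in> {1..<n}"
  shows "r i \<otimes> vec a b = vec b a \<otimes> r i"
proof -
  note c = r_closed[OF i] \<sigma>_closed
  have p: "r i \<otimes> \<sigma> [^] k \<otimes> r i = \<sigma>' [^] k" "r i \<otimes> \<sigma>' [^] k \<otimes> r i = \<sigma> [^] k" for k :: int
    using G.conj_int_pow[OF c(1,2), of k] G.conj_int_pow[OF c(1,3), of k]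
    by (simp_all add: inv_r[OF i] r_conj_\<sigma>[OF i] r_conj_\<sigma>'[OF i])
  have "r i \<otimes> vec a b = (r i \<otimes> \<sigma> [^] a \<otimes> r i) \<otimes> (r i \<otimes> \<sigma>' [^] b \<otimes> r i) \<otimes> r i"
    using c i by (simp add: vec_def G.m_assoc r_cancel r_square)
  also have "\<dots> = vec 0 a \<otimes> vec b 0 \<otimes> r i"
    using c by (simp only: p) (simp add: vec_def)
  also have "\<dots> = vec b a \<otimes> r i" by (simp add: vec_mult)
  finally show ?thesis .
qed

text \<open>Every \<open>r i\<close> exchanges \<open>\<sigma>\<close> and \<open>\<sigma>'\<close>, so the set of such products is closed under left
  multiplication by all generators.\<close>

lemma carrier_normal_form:
  assumes "x \<in> carrier G"
  shows "\<exists>a b. \<exists>y\<in>generate G (r ` {1..<n}). x = vec a b \<otimes> y"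
proof -
  define B where "B = {vec a b \<otimes> y | a b y. y \<in> generate G (r ` {1..<n})}"
  have B_carrier: "y \<in> carrier G" if "y \<in> B" for y
    using that generate_r_closed[of n] vec_closed unfolding B_def by auto
  have s_pow: "\<sigma> [^] k \<otimes> y \<in> B" if yB: "y \<in> B" for y and k :: int
  proof -
    obtain a b z where y: "y = vec a b \<otimes> z" "z \<in> generate G (r ` {1..<n})"
      using yB unfolding B_def by auto
    have *: "\<sigma> [^] k \<otimes> y = vec k 0 \<otimes> vec a b \<otimes> z"
      using y generate_r_closed[of n z] vec_closed
      by (simp add: G.m_assoc) (simp add: vec_def \<sigma>_closed)
    show ?thesis using y(2) unfolding * vec_mult B_def by blast
  qed
  have r_mult: "r i \<otimes> y \<in> B" if yB: "y \<in> B" and i: "i \<in> {1..<n}" for y i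
  proof -
    obtain a b z where y: "y = vec a b \<otimes> z" "z \<in> generate G (r ` {1..<n})"
      using yB unfolding B_def by auto
    have "r i \<otimes> y = r i \<otimes> vec a b \<otimes> z"
      using y generate_r_closed[of n z] vec_closed r_closed[OF i] by (simp add: G.m_assoc)
    also have "\<dots> = vec b a \<otimes> (r i \<otimes> z)"
      using y generate_r_closed[of n z] vec_closed r_closed[OF i]
      by (simp add: r_vec[OF i] G.m_assoc)
    finally have *: "r i \<otimes> y = vec b a \<otimes> (r i \<otimes> z)" .
    have "r i \<otimes> z \<in> generate G (r ` {1..<n})"
      by (intro generate.eng[OF generate.incl y(2)] imageI i)
    then show ?thesis unfolding * B_def by blast
  qed
  have "x \<otimes> y \<in> B" if "y \<in> B" for y
    using assms that unfolding generated
  proof (induction x arbitrary: y rule: generate.induct)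
    case one
    then show ?case using B_carrier[OF one.prems] by simp
  next
    case (incl x)
    then consider i where "x = s i" "i \<in> {1..<n}" | i where "x = r i" "i \<in> {1..<n}" by blast
    then show ?case
    proof cases
      case 1
      then show ?thesis using s_pow[OF incl.prems, of 1] s_eq \<sigma>_closed by simp
    qed (use r_mult[OF incl.prems] in simp)
  next
    case (inv x)
    then consider i where "x = s i" "i \<in> {1..<n}" | i where "x = r i" "i \<in> {1..<n}" by blast
    then show ?case
    proof cases
      case 1
      then show ?thesis using s_pow[OF inv.prems, of "-1"] s_eq \<sigma>_closed
        by (simp add: G.int_pow_neg)
    qed (use r_mult[OF inv.prems] inv_r in simp)
  next
    case (eng x1 x2)
    then have "x1 \<otimes> x2 \<otimes> y = x1 \<otimes> (x2 \<otimes> y)"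
      using B_carrier[OF eng.prems] unfolding generated[symmetric] by (simp add: G.m_assoc)
    then show ?case using eng by simp
  qed
  moreover have "vec 0 0 \<otimes> \<one> \<in> B"
    unfolding B_def using generate.one by blast
  ultimately have "x \<otimes> (vec 0 0 \<otimes> \<one>) \<in> B" .
  moreover have "x \<otimes> (vec 0 0 \<otimes> \<one>) = x" using assms by (simp add: vec_def)
  ultimately show ?thesis unfolding B_def by auto
qed

text \<open>In the normal form of an element of the kernel, the factor in the subgroup generated by the
  \<open>r i\<close> is itself in the kernel, so it is trivial by \<open>coxeter_presentation_faithful\<close>.\<close>

lemma kernel_normal_form:
  assumes "x \<in> kernel G (sym_group n) h"
  shows "\<exists>a b. x = vec a b"
proof -
  have x: "x \<in> carrier G" "h x = id" using assms by (auto simp: kernel_def sym_group_one)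
  obtain a b y where y: "y \<in> generate G (r ` {1..<n})" "x = vec a b \<otimes> y"
    using carrier_normal_form[OF x(1)] by blast
  have "h (vec a b) = id" using vec_kernel[of a b] by (simp add: kernel_def sym_group_one)
  then have "h y = id"
    using x y generate_r_closed[of n y] vec_closed by (simp add: sym_group_mult)
  then have "y = \<one>" using y coxeter_presentation_faithful by blast
  then show ?thesis using y vec_closed by auto
qed

text \<open>Both factors of \<open>r 1 \<otimes> r 2\<close> exchange \<open>\<sigma>\<close> and \<open>\<sigma>'\<close>, so the product centralizes the
  kernel. It is not trivial, since it maps to a 3-cycle, and it is a torsion element because the
  \<open>r i\<close> generate a subgroup that embeds into a finite group.\<close>

lemma not_crystallographic:
  assumes "3 \<le> n"
  shows "\<not> crystallographic G"
proof
  assume cr: "crystallographic G"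
  define t where "t = r 1 \<otimes> r 2"
  have i: "1 \<in> {1..<n}" "2 \<in> {1..<n}" using assms by auto
  note c = i[THEN r_closed]
  have t: "t \<in> carrier G" using c by (simp add: t_def)
  have fin: "finite (carrier (sym_group n))"
    by (simp add: sym_group_def finite_permutations)
  have "t [^] order (sym_group n) \<in> generate G (r ` {1..<n})"
  proof -
    have "subgroup (generate G (r ` {1..<n})) G"
      by (intro G.generate_is_subgroup) (auto intro!: r_closed)
    moreover have "t \<in> generate G (r ` {1..<n})"
      unfolding t_def using i by (intro generate.eng generate.incl imageI)
    ultimately show ?thesis
      using G.subgroup_int_pow_closed[of _ t "int (order (sym_group n))"] by (simp add: int_pow_int)
  qed
  moreover have "h (t [^] order (sym_group n)) = id"
    using t H.pow_order_eq_1[of "h t"] by (simp add: hom_nat_pow sym_group_one)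
  ultimately have torsion: "t [^] order (sym_group n) = \<one>"
    by (rule coxeter_presentation_faithful)
  have "order (sym_group n) > 0"
    using fin H.one_closed by (auto simp: order_def card_gt_0_iff)
  moreover have "t \<otimes> x = x \<otimes> t" if x: "x \<in> kernel G (sym_group n) h" for x
  proof -
    obtain a b where x: "x = vec a b" using kernel_normal_form[OF x] by blast
    have "t \<otimes> x = r 1 \<otimes> (r 2 \<otimes> vec a b)"
      using c vec_closed by (simp add: t_def x G.m_assoc)
    also have "\<dots> = (r 1 \<otimes> vec b a) \<otimes> r 2"
      using c vec_closed by (simp add: r_vec[OF i(2)] G.m_assoc)
    also have "\<dots> = vec a b \<otimes> r 1 \<otimes> r 2" by (simp only: r_vec[OF i(1)])
    also have "\<dots> = x \<otimes> t"
      using c vec_closed by (simp add: t_def x G.m_assoc)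
    finally show ?thesis .
  qed
  ultimately have "t = \<one>"
    using crystallographic_torsion_centralizing_kernel_trivial[OF cr group_hom_axioms fin t torsion]
    by blast
  moreover have "h t 2 = 3" using c h_r[OF i(1)] h_r[OF i(2)]
    by (simp add: t_def sym_group_mult transpose_def)
  ultimately show False using hom_one by (simp add: sym_group_one)
qed

end

section \<open>A plane action of the virtual braid group on two strands\<close>

definition translation :: "int \<Rightarrow> int \<Rightarrow> int \<times> int \<Rightarrow> int \<times> int" where
  "translation a b = (\<lambda>(x, y). (x + a, y + b))"

text \<open>An action of \<open>VB 2\<close> on the plane lattice in which \<open>\<sigma>\<close> and its conjugate by \<open>\<rho>\<close> translate in the
  two coordinate directions. It serves to show that \<open>\<sigma>\<close> and \<open>\<sigma>'\<close> are independent in the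
  quotient.\<close>

definition plane_action :: "vb_gen \<Rightarrow> int \<times> int \<Rightarrow> int \<times> int" where
  "plane_action g = (case g of Sg _ \<Rightarrow> translation 1 0 | Rh _ \<Rightarrow> prod.swap)"

text \<open>On a set \<open>S\<close>, the elements of \<open>BijGroup S\<close> are extensional functions; on \<open>UNIV\<close> this is no
  constraint, and the operations are the usual ones.\<close>

abbreviation plane_bijections :: "(int \<times> int \<Rightarrow> int \<times> int) monoid" where
  "plane_bijections \<equiv> BijGroup UNIV"

lemma plane_bijections_simps:
  "carrier plane_bijections = {f. bij f}"
  "bij f \<Longrightarrow> bij g \<Longrightarrow> f \<otimes>\<^bsub>plane_bijections\<^esub> g = f \<circ> g"
  "\<one>\<^bsub>plane_bijections\<^esub> = id"
  by (auto simp: BijGroup_def Bij_def compose_def fun_eq_iff)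

lemma bij_translation: "bij (translation a b)"
  by (rule o_bij[of "translation (- a) (- b)"]) (auto simp: translation_def fun_eq_iff)

lemma translation_comp: "translation a b \<circ> translation c d = translation (a + c) (b + d)"
  by (auto simp: translation_def fun_eq_iff)

lemma translation_zero: "translation 0 0 = id"
  by (auto simp: translation_def)

lemma swap_translation: "prod.swap \<circ> translation a b = translation b a \<circ> prod.swap"
  by (auto simp: translation_def fun_eq_iff)

lemma translation_int_pow:
  "translation a b [^]\<^bsub>plane_bijections\<^esub> (k::int) = translation (k * a) (k * b)"
proof -
  have "(\<lambda>k. translation (k * a) (k * b)) \<in> hom integer_group plane_bijections"
    by (rule homI)
      (auto simp: plane_bijections_simps bij_translation translation_comp algebra_simps)
  from hom_int_pow[OF this, of 1 k] show ?thesis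
    by (simp add: group_BijGroup)
qed

lemma inv_plane_bijections:
  "inv\<^bsub>plane_bijections\<^esub> translation a b = translation (- a) (- b)"
  "inv\<^bsub>plane_bijections\<^esub> prod.swap = prod.swap"
proof -
  interpret group plane_bijections by (rule group_BijGroup)
  show "inv\<^bsub>plane_bijections\<^esub> translation a b = translation (- a) (- b)"
    by (rule inv_equality)
      (auto simp: plane_bijections_simps bij_translation translation_comp translation_zero)
  show "inv\<^bsub>plane_bijections\<^esub> prod.swap = prod.swap"
    by (rule inv_equality) (auto simp: plane_bijections_simps bij_swap fun_eq_iff)
qed

lemma plane_action_closed: "plane_action \<in> X \<rightarrow> carrier plane_bijections"
  by (auto simp: plane_action_def plane_bijections_simps bij_translation bij_swap split: vb_gen.split)

lemma VB2_rels: "VB_rels 2 = {([rh 1, rh 1], [])}"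
  by (auto simp: VB_rels_def)

lemma plane_action_rels:
  "(u, v) \<in> VB_rels 2 \<Longrightarrow>
    word_eval plane_bijections plane_action u = word_eval plane_bijections plane_action v"
  by (simp add: VB2_rels plane_action_def plane_bijections_simps bij_swap fun_eq_iff)

definition plane_rep :: "vb_gen gword set \<Rightarrow> int \<times> int \<Rightarrow> int \<times> int" where
  "plane_rep = presented_hom plane_bijections plane_action"

lemma plane_rep_hom: "group_hom (VB 2) plane_bijections plane_rep"
  unfolding plane_rep_def VB_def
  by (intro group_hom.intro group_hom_axioms.intro group_presented_group group_BijGroup
      presented_hom_hom plane_action_closed plane_action_rels)

lemma plane_rep_class:
  "w \<in> gwords (VB_gens 2) \<Longrightarrow> plane_rep (word_class (VB_gens 2) (VB_rels 2) w) =
    word_eval plane_bijections plane_action w"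
  unfolding plane_rep_def
  by (rule presented_hom_class[OF group_BijGroup plane_action_closed plane_action_rels])

text \<open>The linear part of the action of a word is recorded by its permutation. In particular
  elements of \<open>KB 2\<close> act by translations, which commute.\<close>

lemma plane_action_word:
  assumes "w \<in> gwords (VB_gens 2)"
  shows "word_eval (sym_group 2) vb_gen_perm w \<in> {id, transpose 1 2} \<and>
    (\<exists>a b. word_eval plane_bijections plane_action w = translation a b \<circ>
      (if word_eval (sym_group 2) vb_gen_perm w = id then id else prod.swap))"
  using assms
proof (induction w)
  case Nil
  have p: "word_eval (sym_group 2) vb_gen_perm [] = id" by (simp add: sym_group_one)
  have e: "word_eval plane_bijections plane_action [] =
      translation 0 0 \<circ> (if id = (id :: nat \<Rightarrow> nat) then id else prod.swap)"
    by (simp add: plane_bijections_simps translation_zero)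
  show ?case unfolding p e by blast
next
  case (Cons l w)
  obtain x \<epsilon> where l: "l = (x, \<epsilon>)" by fastforce
  let ?t = "transpose (1::nat) 2"
  let ?p = "word_eval (sym_group 2) vb_gen_perm w"
  let ?e = "word_eval plane_bijections plane_action w"
  have "w \<in> gwords (VB_gens 2)" using Cons.prems by simp
  from Cons.IH[OF this] obtain a b where
    ab: "?e = translation a b \<circ> (if ?p = id then id else prod.swap)" and p: "?p = id \<or> ?p = ?t"
    by blast
  have bij: "bij ?e" unfolding ab by (auto intro: bij_comp bij_translation bij_swap)
  have ne: "?t \<noteq> id" by (metis id_apply transpose_apply_first numeral_One numeral_eq_iff num.distinct(1))
  have t: "?t \<in> carrier (sym_group 2)" by (simp add: sym_group_carrier permutes_swap_id)
  have inv_t: "inv\<^bsub>sym_group 2\<^esub> ?t = ?t" and inv_id: "inv\<^bsub>sym_group 2\<^esub> id = id"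
    using t by (auto intro!: group.inv_equality[OF sym_group_is_group]
      simp: sym_group_mult sym_group_one sym_group_carrier permutes_id simp del: sym_group_inv_equality)
  from Cons.prems l consider "x = Sg 1" | "x = Rh 1" by (force simp: VB_gens_def)
  then show ?case
  proof cases
    case 1
    let ?c = "if \<epsilon> then 1 else - 1 :: int"
    have e: "word_eval plane_bijections plane_action (l # w) = translation ?c 0 \<circ> ?e"
      using bij by (simp add: l 1 plane_action_def inv_plane_bijections plane_bijections_simps bij_translation)
    have p': "word_eval (sym_group 2) vb_gen_perm (l # w) = ?p"
      using inv_id by (simp add: l 1 vb_gen_perm_def sym_group_mult del: sym_group_inv_equality)
    show ?thesis
      unfolding e p' ab comp_assoc[symmetric] translation_comp using p by blast
  next
    case 2
    have e: "word_eval plane_bijections plane_action (l # w) = prod.swap \<circ> ?e"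
      using bij by (simp add: l 2 plane_action_def inv_plane_bijections plane_bijections_simps bij_swap)
    have p': "word_eval (sym_group 2) vb_gen_perm (l # w) = ?t \<circ> ?p"
      using inv_t by (simp add: l 2 vb_gen_perm_def sym_group_mult numeral_2_eq_2 del: sym_group_inv_equality)
    have W: "prod.swap \<circ> (if ?p = id then id else prod.swap) =
        (if ?t \<circ> ?p = id then id else prod.swap :: int \<times> int \<Rightarrow> int \<times> int)"
      and tp: "?t \<circ> ?p = id \<or> ?t \<circ> ?p = ?t"
      using p ne by auto
    have "prod.swap \<circ> ?e = translation b a \<circ> (prod.swap \<circ> (if ?p = id then id else prod.swap))"
      unfolding ab comp_assoc[symmetric] swap_translation ..
    then show ?thesis unfolding e p' W using tp by blast
  qed
qed

lemma plane_rep_KB: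
  assumes "x \<in> KB 2"
  shows "\<exists>a b. plane_rep x = translation a b"
proof -
  have x: "x \<in> carrier (VB 2)" "pi_K 2 x = id"
    using assms by (auto simp: KB_def kernel_def sym_group_one)
  obtain w where w: "w \<in> gwords (VB_gens 2)" "x = word_class (VB_gens 2) (VB_rels 2) w"
    using x(1) by (auto simp: VB_def carrier_presented_group)
  have "word_eval (sym_group 2) vb_gen_perm w = id"
    using x(2) unfolding w(2) pi_K_def
    by (subst (asm) presented_hom_class[OF sym_group_is_group vb_gen_perm_closed vb_gen_perm_rels w(1)])
  then show ?thesis
    using plane_action_word[OF w(1)] by (auto simp: w(2) plane_rep_class[OF w(1)])
qed

lemma derived_KB_plane_rep: "derived (VB 2) (KB 2) \<subseteq> kernel (VB 2) plane_bijections plane_rep"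
proof -
  interpret f: group_hom "VB 2" plane_bijections plane_rep by (rule plane_rep_hom)
  interpret K: normal "KB 2" "VB 2" by (rule KB_normal)
  have "x \<otimes>\<^bsub>VB 2\<^esub> y \<otimes>\<^bsub>VB 2\<^esub> inv\<^bsub>VB 2\<^esub> x \<otimes>\<^bsub>VB 2\<^esub> inv\<^bsub>VB 2\<^esub> y \<in> kernel (VB 2) plane_bijections plane_rep"
    if x: "x \<in> KB 2" and y: "y \<in> KB 2" for x y
  proof -
    obtain a b c d where "plane_rep x = translation a b" "plane_rep y = translation c d"
      using plane_rep_KB x y by meson
    then show ?thesis using x y K.mem_carrier
      by (simp add: kernel_def inv_plane_bijections plane_bijections_simps bij_translation
          bij_comp translation_comp translation_zero)
  qed
  then show ?thesis
    unfolding derived_def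
    by (intro f.G.generate_subgroup_incl f.subgroup_kernel) auto
qed

section \<open>The quotient by the commutator subgroup of the kernel\<close>

abbreviation quotient_class :: "nat \<Rightarrow> vb_gen gword \<Rightarrow> vb_gen gword set set" where
  "quotient_class n w \<equiv> derived (VB n) (KB n) #>\<^bsub>VB n\<^esub> word_class (VB_gens n) (VB_rels n) w"

text \<open>The kernel is abelian because its elements lift to \<open>KB n\<close>, whose commutators become
  trivial in the quotient.\<close>

lemma quotient_presentation:
  assumes n: "2 \<le> n"
  obtains h where
    "virtual_braid_image (VB n Mod derived (VB n) (KB n)) n h
      (\<lambda>i. quotient_class n [rh i]) (\<lambda>i. quotient_class n [sg i])"
proof -
  let ?D = "derived (VB n) (KB n)" and ?X = "VB_gens n"
  let ?G = "VB n Mod ?D"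
  let ?r = "\<lambda>i. quotient_class n [rh i]" and ?s = "\<lambda>i. quotient_class n [sg i]"
  interpret D: normal ?D "VB n" by (rule derived_KB_normal)
  interpret K: normal "KB n" "VB n" by (rule KB_normal)
  interpret G: group ?G by (rule D.factorgroup_is_group)
  interpret pi: group_hom "VB n" "sym_group n" "pi_K n"
    by (intro group_hom.intro group_hom_axioms.intro group_VB sym_group_is_group pi_K_hom)
  interpret q: group_hom "VB n" ?G "\<lambda>x. ?D #>\<^bsub>VB n\<^esub> x"
    by (intro group_hom.intro group_hom_axioms.intro group_VB G.group_axioms D.r_coset_hom_Mod)
  have DK: "?D \<subseteq> kernel (VB n) (sym_group n) (pi_K n)"
    unfolding KB_def[symmetric] by (intro D.derived_incl K.subgroup_axioms subset_refl)
  obtain h where h: "h \<in> hom ?G (sym_group n)"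
      "\<And>x. x \<in> carrier (VB n) \<Longrightarrow> h (?D #>\<^bsub>VB n\<^esub> x) = pi_K n x"
    using pi.FactGroup_universal_kernel[OF derived_KB_normal DK] by blast
  have class_closed: "word_class ?X (VB_rels n) w \<in> carrier (VB n)" if "w \<in> gwords ?X" for w
    using that by (simp add: VB_def carrier_presented_group)
  have q_closed: "quotient_class n w \<in> carrier ?G" if "w \<in> gwords ?X" for w
    using q.hom_closed[OF class_closed[OF that]] .
  have q_append: "quotient_class n (u @ v) = quotient_class n u \<otimes>\<^bsub>?G\<^esub> quotient_class n v"
    if "u \<in> gwords ?X" "v \<in> gwords ?X" for u v
    using q.hom_mult[OF class_closed[OF that(1)] class_closed[OF that(2)]] that
    by (simp add: VB_def mult_presented_group)
  have q_Nil: "quotient_class n [] = \<one>\<^bsub>?G\<^esub>"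
    using q.hom_one by (simp add: VB_def one_presented_group)
  have q_eq: "quotient_class n u = quotient_class n v" if "(u, v) \<in> word_eq ?X (VB_rels n)" for u v
    using word_class_eq_iff[of u ?X v "VB_rels n"] word_eq_gwords[OF that] that by simp
  have q_rel: "quotient_class n u = quotient_class n v"
    if "(u, v) \<in> VB_rels n" "u \<in> gwords ?X" "v \<in> gwords ?X" for u v
    using q_eq word_eq.relation that by blast
  have q2: "quotient_class n [a, b] = quotient_class n [a] \<otimes>\<^bsub>?G\<^esub> quotient_class n [b]"
    if "fst a \<in> ?X" "fst b \<in> ?X" for a b
    using q_append[of "[a]" "[b]"] that by simp
  have q3: "quotient_class n [a, b, c] =
      quotient_class n [a] \<otimes>\<^bsub>?G\<^esub> quotient_class n [b] \<otimes>\<^bsub>?G\<^esub> quotient_class n [c]"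
    if "fst a \<in> ?X" "fst b \<in> ?X" "fst c \<in> ?X" for a b c
    using q_append[of "[a, b]" "[c]"] q2[of a b] that by simp
  have gen: "Sg i \<in> ?X" "Rh i \<in> ?X" if "i \<in> {1..<n}" for i
    using that by (auto simp: VB_gens_def)
  have gen': "Sg i \<in> ?X" "Rh i \<in> ?X" "Sg (i + 1) \<in> ?X" "Rh (i + 1) \<in> ?X"
    if "1 \<le> i" "i + 2 \<le> n" for i
    using that by (auto intro!: gen)
  have q_inv: "quotient_class n [(x, False)] = inv\<^bsub>?G\<^esub> quotient_class n [(x, True)]" if "x \<in> ?X" for x
  proof -
    have "quotient_class n [(x, False)] \<otimes>\<^bsub>?G\<^esub> quotient_class n [(x, True)] = \<one>\<^bsub>?G\<^esub>"
      using q_eq[OF word_eq.cancel[OF that, of False]] that by (simp add: q2 q_Nil)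
    then show ?thesis using that by (intro G.inv_equality[symmetric] q_closed) auto
  qed
  have closed: "?r i \<in> carrier ?G" "?s i \<in> carrier ?G" if "i \<in> {1..<n}" for i
    using gen[OF that] by (auto intro!: q_closed)
  have h_gens: "h (?r i) = transpose i (i + 1)" "h (?s i) = id" if "i \<in> {1..<n}" for i
    using gen[OF that] pi_K_gens[OF that] by (simp_all add: h class_closed)
  have square: "?r i \<otimes>\<^bsub>?G\<^esub> ?r i = \<one>\<^bsub>?G\<^esub>" if i: "i \<in> {1..<n}" for i
  proof -
    have "([rh i, rh i], []) \<in> VB_rels n" using i by (auto simp: VB_rels_def)
    from q_rel[OF this] gen[OF i] show ?thesis by (simp add: q2 q_Nil del: mult_FactGroup one_FactGroup)
  qed
  have r_braid: "?r i \<otimes>\<^bsub>?G\<^esub> ?r (i + 1) \<otimes>\<^bsub>?G\<^esub> ?r i = ?r (i + 1) \<otimes>\<^bsub>?G\<^esub> ?r i \<otimes>\<^bsub>?G\<^esub> ?r (i + 1)"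
    if i: "1 \<le> i" "i + 2 \<le> n" for i
  proof -
    have "([rh i, rh (i+1), rh i], [rh (i+1), rh i, rh (i+1)]) \<in> VB_rels n"
      using i by (auto simp: VB_rels_def)
    from q_rel[OF this] gen'[OF i] show ?thesis by (simp add: q3 del: mult_FactGroup)
  qed
  have s_braid: "?s i \<otimes>\<^bsub>?G\<^esub> ?s (i + 1) \<otimes>\<^bsub>?G\<^esub> ?s i = ?s (i + 1) \<otimes>\<^bsub>?G\<^esub> ?s i \<otimes>\<^bsub>?G\<^esub> ?s (i + 1)"
    if i: "1 \<le> i" "i + 2 \<le> n" for i
  proof -
    have "([sg i, sg (i+1), sg i], [sg (i+1), sg i, sg (i+1)]) \<in> VB_rels n"
      using i by (auto simp: VB_rels_def)
    from q_rel[OF this] gen'[OF i] show ?thesis by (simp add: q3 del: mult_FactGroup)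
  qed
  have mixed: "?r i \<otimes>\<^bsub>?G\<^esub> ?r (i + 1) \<otimes>\<^bsub>?G\<^esub> ?s i = ?s (i + 1) \<otimes>\<^bsub>?G\<^esub> ?r i \<otimes>\<^bsub>?G\<^esub> ?r (i + 1)"
    if i: "1 \<le> i" "i + 2 \<le> n" for i
  proof -
    have "([rh i, rh (i+1), sg i], [sg (i+1), rh i, rh (i+1)]) \<in> VB_rels n"
      using i by (auto simp: VB_rels_def)
    from q_rel[OF this] gen'[OF i] show ?thesis by (simp add: q3 del: mult_FactGroup)
  qed
  have far: "?r i \<otimes>\<^bsub>?G\<^esub> ?r j = ?r j \<otimes>\<^bsub>?G\<^esub> ?r i"
    if i: "i \<in> {1..<n}" and j: "j \<in> {1..<n}" and ij: "i + 2 \<le> j" for i j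
  proof -
    have "\<bar>int i - int j\<bar> \<ge> 2" using ij by simp
    then have "([rh i, rh j], [rh j, rh i]) \<in> VB_rels n"
      using i j by (auto simp: VB_rels_def)
    from q_rel[OF this] gen[OF i] gen[OF j] show ?thesis by (simp add: q2 del: mult_FactGroup)
  qed
  have mem: "quotient_class n w \<in> generate ?G (?s ` {1..<n} \<union> ?r ` {1..<n})"
    if "w \<in> gwords ?X" for w
    using that
  proof (induction w)
    case Nil
    show ?case unfolding q_Nil by (rule generate.one)
  next
    case (Cons l w)
    obtain x b where l: "l = (x, b)" by fastforce
    have x: "x \<in> ?X" using Cons.prems l by simp
    have xT: "quotient_class n [(x, True)] \<in> ?s ` {1..<n} \<union> ?r ` {1..<n}"
      using x by (auto simp: VB_gens_def)
    then have "quotient_class n [l] \<in> generate ?G (?s ` {1..<n} \<union> ?r ` {1..<n})"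
      unfolding l using generate.incl[OF xT, of ?G] generate.inv[OF xT, of ?G] q_inv[OF x]
      by (cases b) simp_all
    moreover have "quotient_class n (l # w) = quotient_class n [l] \<otimes>\<^bsub>?G\<^esub> quotient_class n w"
      using q_append[of "[l]" w] Cons.prems by simp
    moreover have "quotient_class n w \<in> generate ?G (?s ` {1..<n} \<union> ?r ` {1..<n})"
      using Cons by simp
    ultimately show ?case by (simp only: generate.eng)
  qed
  have generated: "carrier ?G = generate ?G (?s ` {1..<n} \<union> ?r ` {1..<n})"
  proof
    show "generate ?G (?s ` {1..<n} \<union> ?r ` {1..<n}) \<subseteq> carrier ?G"
      by (rule G.generate_incl) (auto intro!: q_closed gen)
    show "carrier ?G \<subseteq> generate ?G (?s ` {1..<n} \<union> ?r ` {1..<n})"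
    proof
      fix A assume "A \<in> carrier ?G"
      then obtain x where "x \<in> carrier (VB n)" "A = ?D #>\<^bsub>VB n\<^esub> x"
        by (auto simp: FactGroup_def RCOSETS_def)
      then show "A \<in> generate ?G (?s ` {1..<n} \<union> ?r ` {1..<n})"
        using mem by (auto simp: VB_def carrier_presented_group)
    qed
  qed
  have kernel: "A \<otimes>\<^bsub>?G\<^esub> B = B \<otimes>\<^bsub>?G\<^esub> A"
    if A: "A \<in> kernel ?G (sym_group n) h" and B: "B \<in> kernel ?G (sym_group n) h" for A B
  proof -
    have lift: "\<exists>x\<in>KB n. A = ?D #>\<^bsub>VB n\<^esub> x" if A: "A \<in> kernel ?G (sym_group n) h" for A
    proof -
      have Ah: "A \<in> carrier ?G" "h A = \<one>\<^bsub>sym_group n\<^esub>"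
        using A unfolding kernel_def by blast+
      obtain x where x: "x \<in> carrier (VB n)" "A = ?D #>\<^bsub>VB n\<^esub> x"
        using Ah(1) unfolding FactGroup_def RCOSETS_def by auto
      have "pi_K n x = \<one>\<^bsub>sym_group n\<^esub>" using h(2)[OF x(1)] Ah(2) x(2) by metis
      then have "x \<in> KB n" unfolding KB_def kernel_def using x(1) by blast
      with x(2) show ?thesis by (intro bexI[of _ x])
    qed
    obtain x y where x: "x \<in> KB n" "A = ?D #>\<^bsub>VB n\<^esub> x" and y: "y \<in> KB n" "B = ?D #>\<^bsub>VB n\<^esub> y"
      using lift[OF A] lift[OF B] by blast
    note c = K.mem_carrier[OF x(1)] K.mem_carrier[OF y(1)]
    let ?k = "x \<otimes>\<^bsub>VB n\<^esub> y \<otimes>\<^bsub>VB n\<^esub> inv\<^bsub>VB n\<^esub> x \<otimes>\<^bsub>VB n\<^esub> inv\<^bsub>VB n\<^esub> y"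
    \<comment> \<open>The commutator \<open>?k\<close> is killed, and \<open>x \<otimes> y\<close> is its product with \<open>y \<otimes> x\<close>.\<close>
    have kD: "?k \<in> ?D" unfolding derived_def by (rule generate.incl) (use x(1) y(1) in blast)
    have kc: "?k \<in> carrier (VB n)" using c by simp
    have k: "?D #>\<^bsub>VB n\<^esub> ?k = \<one>\<^bsub>?G\<^esub>"
      unfolding one_FactGroup by (rule D.coset_join2[OF kc D.subgroup_axioms kD])
    have ky: "?k \<otimes>\<^bsub>VB n\<^esub> y = x \<otimes>\<^bsub>VB n\<^esub> y \<otimes>\<^bsub>VB n\<^esub> inv\<^bsub>VB n\<^esub> x"
      using c by (simp add: D.m_assoc)
    have "x \<otimes>\<^bsub>VB n\<^esub> y = x \<otimes>\<^bsub>VB n\<^esub> y \<otimes>\<^bsub>VB n\<^esub> inv\<^bsub>VB n\<^esub> x \<otimes>\<^bsub>VB n\<^esub> x"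
      using c by (simp add: D.m_assoc)
    also have "\<dots> = ?k \<otimes>\<^bsub>VB n\<^esub> y \<otimes>\<^bsub>VB n\<^esub> x" by (simp only: ky)
    also have "\<dots> = ?k \<otimes>\<^bsub>VB n\<^esub> (y \<otimes>\<^bsub>VB n\<^esub> x)" by (rule D.m_assoc[OF kc c(2,1)])
    finally have xy: "x \<otimes>\<^bsub>VB n\<^esub> y = ?k \<otimes>\<^bsub>VB n\<^esub> (y \<otimes>\<^bsub>VB n\<^esub> x)" .
    have "A \<otimes>\<^bsub>?G\<^esub> B = ?D #>\<^bsub>VB n\<^esub> (x \<otimes>\<^bsub>VB n\<^esub> y)"
      unfolding x(2) y(2) by (rule q.hom_mult[OF c, symmetric])
    also have "\<dots> = ?D #>\<^bsub>VB n\<^esub> (?k \<otimes>\<^bsub>VB n\<^esub> (y \<otimes>\<^bsub>VB n\<^esub> x))"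
      by (simp only: xy[symmetric])
    also have "\<dots> = (?D #>\<^bsub>VB n\<^esub> ?k) \<otimes>\<^bsub>?G\<^esub> (?D #>\<^bsub>VB n\<^esub> (y \<otimes>\<^bsub>VB n\<^esub> x))"
      by (rule q.hom_mult[OF kc D.m_closed[OF c(2,1)]])
    also have "\<dots> = ?D #>\<^bsub>VB n\<^esub> (y \<otimes>\<^bsub>VB n\<^esub> x)"
      unfolding k by (rule G.l_one[OF q.hom_closed[OF D.m_closed[OF c(2,1)]]])
    also have "\<dots> = B \<otimes>\<^bsub>?G\<^esub> A"
      unfolding x(2) y(2) by (rule q.hom_mult[OF c(2,1)])
    finally show ?thesis .
  qed
  have "virtual_braid_image ?G n h ?r ?s"
    by (intro virtual_braid_image.intro symmetric_generators.intro group_hom.intro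
      group_hom_axioms.intro symmetric_generators_axioms.intro virtual_braid_image_axioms.intro)
      (fact G.group_axioms sym_group_is_group h(1) closed h_gens square r_braid s_braid mixed far
        generated kernel n)+
  then show thesis by (rule that)
qed


text \<open>The lattice is the kernel, with coordinates given by \<open>vec\<close>; these are independent because
  \<open>vec a b\<close> acts on the plane as a translation by \<open>(a, b)\<close>. The nontrivial permutation acts by
  exchanging the coordinates, which is not the identity, so the representation is faithful.\<close>

lemma (in virtual_braid_image) crystallographic_if_plane_action:
  assumes n: "n = 2" and f: "group_hom G plane_bijections f"
    and f_s: "f (s 1) = translation 1 0" and f_r: "f (r 1) = prod.swap"
  shows "crystallographic G"
proof -
  interpret f: group_hom G plane_bijections f by fact
  interpret Z: group "Z_power 2" by (rule group_Z_power)
  define \<iota> where "\<iota> z = vec (z 0) (z 1)" for z :: "nat \<Rightarrow> int"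
  define flip where "flip z = (\<lambda>i\<in>{..<2}. z (1 - i))" for z :: "nat \<Rightarrow> int"
  define \<theta> where "\<theta> p = (if p = id then (\<lambda>z\<in>carrier (Z_power 2). z)
      else (\<lambda>z\<in>carrier (Z_power 2). flip z))" for p :: "nat \<Rightarrow> nat"
  let ?S = "sym_group n" and ?t = "transpose (1::nat) 2"
  have one_n: "1 \<in> {1..<n}" using n by simp
  have Z_eqI: "z = w" if "z \<in> carrier (Z_power 2)" "w \<in> carrier (Z_power 2)" "z 0 = w 0" "z 1 = w 1"
    for z w
  proof (rule PiE_ext[of z "{..<2}" "\<lambda>_. UNIV"])
    show "z i = w i" if "i \<in> {..<2}" for i
      using that \<open>z 0 = w 0\<close> \<open>z 1 = w 1\<close> by (cases i) auto
  qed (use that in \<open>simp_all add: Z_power_def\<close>)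
  have flip: "flip z \<in> carrier (Z_power 2)" "flip z 0 = z 1" "flip z (Suc 0) = z 0" for z
    by (auto simp: flip_def Z_power_def)
  have mult: "(z \<otimes>\<^bsub>Z_power 2\<^esub> w) i = z i + w i" if "i < 2" for z w i
    using that by (simp add: Z_power_def)
  have flip_flip: "flip (flip z) = z" if "z \<in> carrier (Z_power 2)" for z
    using that by (intro Z_eqI) (simp_all add: flip)
  have flip_mult: "flip (z \<otimes>\<^bsub>Z_power 2\<^esub> w) = flip z \<otimes>\<^bsub>Z_power 2\<^esub> flip w"
    if "z \<in> carrier (Z_power 2)" "w \<in> carrier (Z_power 2)" for z w
    using that by (intro Z_eqI) (simp_all add: flip mult)
  have S: "p \<in> carrier ?S \<longleftrightarrow> p = id \<or> p = ?t" for p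
  proof -
    have "{1..n} = {1, 2}" using n by auto
    then show ?thesis by (simp add: sym_group_carrier permutes_doubleton_iff)
  qed
  have ne: "?t \<noteq> id" by (metis id_apply transpose_apply_first numeral_One numeral_eq_iff num.distinct(1))
  have \<theta>_id: "\<theta> id = (\<lambda>z\<in>carrier (Z_power 2). z)" and \<theta>_t: "\<theta> ?t = (\<lambda>z\<in>carrier (Z_power 2). flip z)"
    using ne by (simp_all add: \<theta>_def)

  have f_vec: "f (vec a b) = translation a b" for a b
  proof -
    have "f \<sigma> = translation 1 0" unfolding \<sigma>_def by (rule f_s)
    moreover have "f \<sigma>' = translation 0 1"
      using r1 \<sigma>_closed by (simp add: \<sigma>'_def \<sigma>_def f_s f_r plane_bijections_simps bij_translation
          bij_swap bij_comp swap_translation comp_assoc del: One_nat_def)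
    ultimately show ?thesis
      using \<sigma>_closed by (simp add: vec_def f.hom_int_pow translation_int_pow
          plane_bijections_simps bij_translation translation_comp)
  qed
  have vec_inj: "a = c \<and> b = d" if "vec a b = vec c d" for a b c d
    using arg_cong[OF that, of "\<lambda>x. f x (0, 0)"] unfolding f_vec by (simp add: translation_def)

  have \<iota>: "\<iota> \<in> mon (Z_power 2) G"
  proof -
    have "\<iota> \<in> hom (Z_power 2) G"
      by (rule homI) (simp_all add: \<iota>_def vec_closed vec_mult mult)
    moreover have "inj_on \<iota> (carrier (Z_power 2))"
      by (rule inj_onI) (use Z_eqI vec_inj in \<open>unfold \<iota>_def, blast\<close>)
    ultimately show ?thesis by (simp add: mon_def)
  qed
  have \<iota>_image: "\<iota> ` carrier (Z_power 2) = kernel G ?S h"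
  proof
    show "\<iota> ` carrier (Z_power 2) \<subseteq> kernel G ?S h" by (auto simp: \<iota>_def vec_kernel)
    show "kernel G ?S h \<subseteq> \<iota> ` carrier (Z_power 2)"
    proof
      fix x assume "x \<in> kernel G ?S h"
      then obtain a b where "x = vec a b" using kernel_normal_form by blast
      then have "x = \<iota> (\<lambda>i\<in>{..<2}. if i = 0 then a else b)" by (simp add: \<iota>_def)
      then show "x \<in> \<iota> ` carrier (Z_power 2)" by (auto simp: Z_power_def)
    qed
  qed
  have h_r1: "h (r 1) = ?t" using h_r[OF one_n] by (simp add: numeral_2_eq_2)
  have epi: "h \<in> epi G ?S"
  proof -
    have "carrier ?S \<subseteq> h ` carrier G"
      using imageI[OF r1(1), of h] imageI[OF G.one_closed, of h]
      unfolding h_r1 hom_one sym_group_one subset_iff S by blast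
    then show ?thesis using homh hom_closed by (auto simp: epi_def)
  qed
  have \<theta>_hom: "\<theta> \<in> hom ?S (AutoGroup (Z_power 2))"
  proof (rule homI)
    have flip_auto: "(\<lambda>z\<in>carrier (Z_power 2). flip z) \<in> auto (Z_power 2)"
    proof -
      have "bij_betw flip (carrier (Z_power 2)) (carrier (Z_power 2))"
        by (rule bij_betw_byWitness[of _ flip]) (auto simp: flip_flip flip)
      then have "bij_betw (restrict flip (carrier (Z_power 2))) (carrier (Z_power 2)) (carrier (Z_power 2))"
        by (rule bij_betw_cong[THEN iffD1, rotated]) simp
      moreover have "restrict flip (carrier (Z_power 2)) \<in> hom (Z_power 2) (Z_power 2)"
        by (rule homI) (simp_all add: flip flip_mult)
      ultimately show ?thesis by (simp add: auto_def Bij_def)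
    qed
    then show \<theta>_closed: "\<theta> p \<in> carrier (AutoGroup (Z_power 2))" if "p \<in> carrier ?S" for p
      by (simp add: \<theta>_def AutoGroup_def Z.id_in_auto)
    fix p q assume pq: "p \<in> carrier ?S" "q \<in> carrier ?S"
    have "\<theta> p \<otimes>\<^bsub>AutoGroup (Z_power 2)\<^esub> \<theta> q = compose (carrier (Z_power 2)) (\<theta> p) (\<theta> q)"
      using \<theta>_closed[OF pq(1)] \<theta>_closed[OF pq(2)]
      by (simp add: AutoGroup_def BijGroup_def auto_def)
    also have "\<dots> = \<theta> (p \<circ> q)"
      using pq unfolding S
      by (elim disjE) (simp_all add: \<theta>_id \<theta>_t compose_def flip flip_flip restrict_def
          cong: if_cong del: One_nat_def)
    finally show "\<theta> (p \<otimes>\<^bsub>?S\<^esub> q) = \<theta> p \<otimes>\<^bsub>AutoGroup (Z_power 2)\<^esub> \<theta> q"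
      by (simp add: sym_group_mult)
  qed
  have \<theta>_inj: "inj_on \<theta> (carrier ?S)"
  proof -
    \<comment> \<open>Any vector with distinct coordinates is moved by the exchange.\<close>
    let ?e = "\<lambda>i\<in>{..<2::nat}. int i"
    have e: "?e \<in> carrier (Z_power 2)" by (simp add: Z_power_def)
    have "\<theta> ?t ?e 0 \<noteq> \<theta> id ?e 0" unfolding \<theta>_id \<theta>_t using e by (simp add: flip)
    then have "\<theta> ?t \<noteq> \<theta> id" by metis
    then show ?thesis by (intro inj_onI) (metis S)
  qed
  have conj: "\<iota> (\<theta> (h x) z) = x \<otimes> \<iota> z \<otimes> inv x"
    if x: "x \<in> carrier G" and z: "z \<in> carrier (Z_power 2)" for x z
  proof -
    have kernel_conj: "k \<otimes> vec a b \<otimes> inv k = vec a b" if k: "k \<in> kernel G ?S h" for k a b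
    proof -
      have "k \<in> carrier G" using k by (simp add: kernel_def)
      then show ?thesis
        by (simp add: kernel_commute[OF k vec_kernel] G.m_assoc vec_closed)
    qed
    have "h x = id \<or> h x = ?t" using hom_closed[OF x] S by blast
    then show ?thesis
    proof
      assume hx: "h x = id"
      then have "x \<in> kernel G ?S h" using x by (simp add: kernel_def sym_group_one)
      then show ?thesis using z by (simp add: hx \<theta>_id \<iota>_def kernel_conj)
    next
      assume hx: "h x = ?t"
      \<comment> \<open>Splitting off one reflection leaves a factor in the abelian kernel, which acts trivially.\<close>
      define k where "k = x \<otimes> r 1"
      have k: "k \<in> kernel G ?S h" "k \<in> carrier G"
        using x r1 by (simp_all add: k_def kernel_def sym_group_one sym_group_mult hx h_r1 del: One_nat_def)
      have xk: "x = k \<otimes> r 1"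
        using x r1 r_square[OF one_n] by (simp add: k_def G.m_assoc)
      have "x \<otimes> \<iota> z \<otimes> inv x = k \<otimes> (r 1 \<otimes> vec (z 0) (z 1)) \<otimes> r 1 \<otimes> inv k"
        using k r1 inv_r[OF one_n] by (simp add: xk \<iota>_def G.inv_mult_group G.m_assoc vec_closed)
      also have "\<dots> = k \<otimes> (vec (z 1) (z 0) \<otimes> r 1) \<otimes> r 1 \<otimes> inv k"
        by (simp only: r_vec[OF one_n])
      also have "\<dots> = k \<otimes> vec (z 1) (z 0) \<otimes> inv k"
        using k r1 r_cancel[OF one_n, of "inv k"] by (simp add: G.m_assoc vec_closed)
      also have "\<dots> = vec (z 1) (z 0)" by (rule kernel_conj[OF k(1)])
      also have "\<dots> = \<iota> (\<theta> (h x) z)"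
        using z flip[of z] by (simp add: hx \<theta>_t \<iota>_def del: One_nat_def) (simp only: One_nat_def)
      finally show ?thesis ..
    qed
  qed
  have "finite (carrier ?S)" by (simp add: sym_group_def finite_permutations)
  then have "crystallographic_extension G 2 ?S \<iota> h \<theta>"
    unfolding crystallographic_extension_def
    using sym_group_is_group \<iota> epi \<iota>_image \<theta>_hom conj \<theta>_inj by blast
  then show ?thesis by (rule crystallographicI[OF G.group_axioms])
qed

section \<open>Crystallographic exactly for two strands\<close>

theorem proposition3p17:
  fixes n :: nat
  assumes "n \<ge> 2"
  shows "crystallographic (VB n Mod derived (VB n) (KB n)) \<longleftrightarrow> n = 2"
proof -
  obtain h where "virtual_braid_image (VB n Mod derived (VB n) (KB n)) n h
      (\<lambda>i. quotient_class n [rh i]) (\<lambda>i. quotient_class n [sg i])"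
    using quotient_presentation[OF assms] .
  then interpret G: virtual_braid_image "VB n Mod derived (VB n) (KB n)" n h
      "\<lambda>i. quotient_class n [rh i]" "\<lambda>i. quotient_class n [sg i]" .
  show ?thesis
  proof
    assume "crystallographic (VB n Mod derived (VB n) (KB n))"
    then show "n = 2" using G.not_crystallographic assms by fastforce
  next
    assume n: "n = 2"
    obtain f where f: "f \<in> hom (VB 2 Mod derived (VB 2) (KB 2)) plane_bijections"
        "\<And>x. x \<in> carrier (VB 2) \<Longrightarrow> f (derived (VB 2) (KB 2) #>\<^bsub>VB 2\<^esub> x) = plane_rep x"
      using group_hom.FactGroup_universal_kernel[OF plane_rep_hom derived_KB_normal derived_KB_plane_rep]
      by blast
    have w: "[sg 1] \<in> gwords (VB_gens 2)" "[rh 1] \<in> gwords (VB_gens 2)"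
      by (simp_all add: VB_gens_def)
    have closed: "word_class (VB_gens 2) (VB_rels 2) v \<in> carrier (VB 2)" if "v \<in> gwords (VB_gens 2)" for v
      using that by (simp add: VB_def carrier_presented_group)
    have "f (quotient_class 2 [sg 1]) = translation 1 0" "f (quotient_class 2 [rh 1]) = prod.swap"
      unfolding f(2)[OF closed[OF w(1)]] f(2)[OF closed[OF w(2)]]
        plane_rep_class[OF w(1)] plane_rep_class[OF w(2)]
      by (simp_all add: plane_action_def plane_bijections_simps bij_translation bij_swap)
    then show "crystallographic (VB n Mod derived (VB n) (KB n))"
      using f(1) G.G.group_axioms group_BijGroup
      by (intro G.crystallographic_if_plane_action[OF n, of f])
        (simp_all add: n group_hom_def group_hom_axioms_def)
  qed
qed

end
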